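(* For all integers $m\ge 0$ and $n\ge 1$, \[q(m,n)\le p(-m,n).\]
   Context: For a partition $\lambda$ with parts $\lambda_1\ge\cdots\ge\lambda_\ell>0$, its rank is $\lambda_1-\ell$. The rank-set of $\lambda$ is the infinite sequence $[-\lambda_1,\,1-\lambda_2,\,\dots,\,\ell-1-\lambda_\ell,\,\ell,\,\ell+1,\,\ell+2,\dots]$; "$m$ appears in the rank-set" means $m$ equals one of its entries. $q(m,n)$ is the number of partitions of $n$ whose rank-set contains $m$, and $p(-m,n)$ is the number of partitions of $n$ with rank $\ge -m$. *)

theory Defs
  imports Main
begin

definition partitions :: "nat \<Rightarrow> nat list set" where
  "partitions n = {xs. sorted_wrt (\<ge>) xs \<and> (\<forall>x\<in>set xs. 0 < x) \<and> sum_list xs = n}"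

text \<open>Rank lambda_1 - ell (lambda_1 = hd xs; only used for nonempty partitions).\<close>
definition prank :: "nat list \<Rightarrow> int" where
  "prank xs = int (hd xs) - int (length xs)"

text \<open>Rank-set [-lambda_1, 1-lambda_2, ..., ell-1-lambda_ell, ell, ell+1, ...] as a set of entries
  (0-indexed: entry i is i - xs!i for i < ell, then all k >= ell).\<close>
definition rank_set :: "nat list \<Rightarrow> int set" where
  "rank_set xs = {int i - int (xs ! i) | i. i < length xs} \<union> {k. int (length xs) \<le> k}"

definition q :: "int \<Rightarrow> nat \<Rightarrow> nat" where
  "q m n = card {xs \<in> partitions n. m \<in> rank_set xs}"

definition p :: "int \<Rightarrow> nat \<Rightarrow> nat" where
  "p k n = card {xs \<in> partitions n. k \<le> prank xs}"

end

theory Submission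
  imports Defs "HOL-Computational_Algebra.Formal_Power_Series"
begin

text \<open>
  A partition with more than \<open>m\<close> parts consists of its \<open>(m + j) \<times> j\<close> Durfee rectangle, a partition
  \<open>\<alpha>\<close> to the right of it and a partition \<open>\<beta>\<close> below it. Counting columns of \<open>\<alpha>\<close> and rows of \<open>\<beta>\<close>,
  its rank is at least \<open>-m\<close> iff \<open>\<ell>(\<beta>) \<le> \<ell>(\<alpha>)\<close>, and \<open>m\<close> lies in its rank-set iff the
  largest part of \<open>\<beta>\<close> is \<open>j\<close>. This turns both numbers into double sums over products of two Gaussian
  polynomials. Pascal's rules and shifts of the summation indices rearrange the difference of the
  two sums so that every single summand has nonnegative coefficients, by the q-log-concavity of
  Gaussian polynomials. Only \<open>m = 0\<close> needs a finer rearrangement, which treats partitions without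
  parts equal to 1 separately.
\<close>

section \<open>Gaussian polynomials\<close>

text \<open>Partitions satisfying both conditions cancel, so only those satisfying exactly one of
  them are turned into double sums. At a fixed pair of indices the negative product has larger
  degree than the positive one, so no comparison summand by summand is possible before indices are
  shifted. Shifts are affordable because the growth of the Durfee rectangle from \<open>j\<close> to
  \<open>j + 1\<close> is paid by the powers of \<open>X\<close> that Pascal's rules release, up to
  a small surplus or deficit depending on \<open>m\<close>. Since products compared after a shift
  carry different powers of \<open>X\<close>, log-concavity is needed in a form with a spare factor
  \<open>X ^ e\<close>.\<close>

definition nonneg_fps :: "int fps \<Rightarrow> bool" where
  "nonneg_fps f \<longleftrightarrow> (\<forall>n. 0 \<le> fps_nth f n)"

lemma nonneg_fps_0 [simp]: "nonneg_fps 0"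
  and nonneg_fps_1 [simp]: "nonneg_fps 1"
  and nonneg_fps_X [simp]: "nonneg_fps fps_X"
  by (auto simp: nonneg_fps_def fps_X_def)

lemma nonneg_fps_add: "nonneg_fps f \<Longrightarrow> nonneg_fps g \<Longrightarrow> nonneg_fps (f + g)"
  by (simp add: nonneg_fps_def)

lemma nonneg_fps_mult: "nonneg_fps f \<Longrightarrow> nonneg_fps g \<Longrightarrow> nonneg_fps (f * g)"
  by (auto simp: nonneg_fps_def fps_mult_nth intro!: sum_nonneg)

lemma nonneg_fps_power: "nonneg_fps f \<Longrightarrow> nonneg_fps (f ^ n)"
  by (induction n) (auto intro: nonneg_fps_mult)

lemmas nonneg_fps_intros = nonneg_fps_add nonneg_fps_mult nonneg_fps_power

abbreviation X :: "int fps" where "X \<equiv> fps_X"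

text \<open>The q-binomial coefficient of \<open>a + b\<close> over \<open>a\<close>, indexed by the
  sides of the box: it generates the partitions with at most \<open>a\<close> parts, all at most
  \<open>b\<close>. The recursion asks whether the largest allowed part occurs.\<close>

fun gauss :: "nat \<Rightarrow> nat \<Rightarrow> int fps" where
  "gauss 0 b = 1"
| "gauss (Suc a) 0 = 1"
| "gauss (Suc a) (Suc b) = gauss (Suc a) b + X ^ Suc b * gauss a (Suc b)"

lemma gauss_0_right [simp]: "gauss a 0 = 1"
  by (cases a) auto

lemma nonneg_gauss [simp]: "nonneg_fps (gauss a b)"
  by (induction a b rule: gauss.induct) (auto simp del: power_Suc intro!: nonneg_fps_intros)

text \<open>The conjugate Pascal rule: either fewer than \<open>Suc a\<close> parts are positive, or
  1 can be subtracted from each of them. Expanding by one rule and then by the other gives the same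
  four terms in either order, which drives the induction.\<close>

lemma gauss_Suc_Suc':
  "gauss (Suc a) (Suc b) = gauss a (Suc b) + X ^ Suc a * gauss (Suc a) b"
proof (induction "a + b" arbitrary: a b rule: less_induct)
  case less
  show ?case
  proof (cases a)
    case 0
    show ?thesis
    proof (cases b)
      case 0
      then show ?thesis using \<open>a = 0\<close> by simp
    next
      case (Suc b')
      have 1: "gauss 1 (Suc b') = 1 + X * gauss 1 b'"
        using less[of 0 b'] \<open>a = 0\<close> Suc by simp
      have "gauss (Suc a) (Suc b) = gauss 1 (Suc b') + X ^ Suc b"
        using \<open>a = 0\<close> Suc by simp
      also have "\<dots> = 1 + X * (gauss 1 b' + X ^ b)"
        unfolding 1 by (simp add: algebra_simps)
      also have "gauss 1 b' + X ^ b = gauss 1 b"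
        using Suc by simp
      finally show ?thesis using \<open>a = 0\<close> by simp
    qed
  next
    case (Suc a')
    note a = this
    show ?thesis
    proof (cases b)
      case 0
      have "gauss (Suc a') 1 = gauss a' 1 + X ^ Suc a'"
        using less[of a' 0] a 0 by simp
      then show ?thesis using a 0 by (simp add: algebra_simps)
    next
      case (Suc b')
      have 1: "gauss (Suc a) (Suc b') = gauss a (Suc b') + X ^ Suc a * gauss (Suc a) b'"
        using less[of a b'] Suc by simp
      have 2: "gauss (Suc a') (Suc b) = gauss a' (Suc b) + X ^ Suc a' * gauss (Suc a') b"
        using less[of a' b] a by simp
      have "gauss (Suc a) (Suc b) = gauss (Suc a) b + X ^ Suc b * gauss a (Suc b)"
        by simp
      also have "\<dots> = gauss a b + X ^ Suc a * gauss (Suc a) b' +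
          X ^ Suc b * (gauss a' (Suc b) + X ^ a * gauss a b)"
        using 1 2 Suc a by simp
      also have "\<dots> = gauss a b + X ^ Suc b * gauss a' (Suc b) +
          X ^ Suc a * (gauss (Suc a) b' + X ^ b * gauss a b)"
        by (simp add: algebra_simps)
      also have "gauss a b + X ^ Suc b * gauss a' (Suc b) = gauss a (Suc b)"
        using a by simp
      also have "gauss (Suc a) b' + X ^ b * gauss a b = gauss (Suc a) b"
        using Suc by simp
      finally show ?thesis .
    qed
  qed
qed

lemma gauss_commute: "gauss a b = gauss b a"
proof (induction a b rule: gauss.induct)
  case (3 a b)
  then show ?case using gauss_Suc_Suc'[of b a] by simp
qed simp_all

lemma nonneg_gauss_diff_rows: "nonneg_fps (gauss (Suc a) b - gauss a b)"
proof (cases b)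
  case (Suc b')
  then show ?thesis
    unfolding Suc gauss_Suc_Suc' by (auto simp del: power_Suc intro!: nonneg_fps_intros)
qed auto

lemma nonneg_gauss_diff_cols: "nonneg_fps (gauss a (Suc b) - gauss a b)"
  by (cases a) (auto simp del: power_Suc intro!: nonneg_fps_intros)

text \<open>Inserting a part \<open>c\<close> maps the partitions in the smaller box injectively into the larger one.\<close>

lemma nonneg_gauss_add_part:
  "c \<le> b \<Longrightarrow> nonneg_fps (gauss (Suc a) b - X ^ c * gauss a b)"
proof (induction "a + b" arbitrary: a b rule: less_induct)
  case less
  show ?case
  proof (cases b)
    case 0
    then show ?thesis using less.prems by simp
  next
    case (Suc b')
    note b = this
    show ?thesis
    proof (cases "c = b")
      case True
      then show ?thesis using b by (simp del: power_Suc)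
    next
      case False
      with less.prems b have cb: "c \<le> b'" by simp
      have h: "nonneg_fps (gauss (Suc a) b' - X ^ c * gauss a b')"
        using less.hyps[of a b'] cb b by simp
      show ?thesis
      proof (cases a)
        case 0
        have "gauss (Suc a) b - X ^ c * gauss a b = (gauss (Suc a) b' - X ^ c * gauss a b') + X ^ b"
          using 0 b by (simp add: algebra_simps)
        then show ?thesis using h by (auto intro!: nonneg_fps_intros)
      next
        case (Suc a')
        have h2: "nonneg_fps (gauss (Suc a') b - X ^ c * gauss a' b)"
          using less.hyps[of a' b] less.prems Suc by simp
        have "gauss (Suc a) b - X ^ c * gauss a b =
          (gauss (Suc a) b' - X ^ c * gauss a b') + X ^ b * (gauss (Suc a') b - X ^ c * gauss a' b)"
          using Suc b by (simp add: algebra_simps)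
        then show ?thesis using h h2 by (auto intro!: nonneg_fps_intros)
      qed
    qed
  qed
qed

text \<open>The free exponent \<open>e\<close> makes the induction close. Applying the same Pascal
  rule to one factor of each product leaves a smaller instance plus a power of \<open>X\<close>
  times another one, in which \<open>e\<close> has absorbed the mismatch of the two released powers.
  The hypotheses survive each such step, and when none is possible (\<open>a = b\<close>,
  \<open>e = 0\<close>, \<open>c = d\<close>) the two products coincide.\<close>

lemma gauss_log_concave:
  assumes "b \<le> a" "a \<le> e + b" "e + c \<le> d"
  shows "nonneg_fps (gauss a (Suc c) * gauss (Suc b) d - X ^ e * gauss (Suc a) c * gauss b (Suc d))"
  using assms
proof (induction "a + b + c + d" arbitrary: a b c d e rule: less_induct)
  case less
  let ?F = "\<lambda>a b c d e. gauss a (Suc c) * gauss (Suc b) d - X ^ e * gauss (Suc a) c * gauss b (Suc d)"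
  consider "b < a" | "a = b" "e + c < d" | "a = b" "e + c = d" "0 < e" | "a = b" "e = 0" "c = d"
    using less.prems by linarith
  then show ?case
  proof cases
    case 1
    then obtain a' where a: "a = Suc a'" by (cases a) auto
    have h: "nonneg_fps (?F a' b c d e)"
      using less.hyps[of a' b c d e] less.prems 1 a by simp
    show ?thesis
    proof (cases c)
      case 0
      have "?F a b c d e = ?F a' b c d e + X ^ a * gauss (Suc b) d"
        unfolding 0 unfolding a gauss_Suc_Suc' by (simp add: algebra_simps)
      then show ?thesis using h by (auto simp del: gauss.simps intro!: nonneg_fps_intros)
    next
      case (Suc c')
      have h2: "nonneg_fps (?F a b c' d (Suc e))"
        using less.hyps[of a b c' d "Suc e"] less.prems 1 Suc by simp
      have 1: "gauss a (Suc c) = gauss a' (Suc c) + X ^ a * gauss a c"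
        unfolding a gauss_Suc_Suc' by simp
      have 2: "gauss (Suc a) c = gauss a c + X ^ Suc a * gauss (Suc a) c'"
        unfolding Suc gauss_Suc_Suc' by simp
      have "?F a b c d e = ?F a' b c d e + X ^ a * ?F a b c' d (Suc e)"
        unfolding 1 2 a[symmetric] Suc[symmetric] by (simp add: algebra_simps del: gauss.simps)
      then show ?thesis using h h2 by (metis nonneg_fps_intros nonneg_fps_X)
    qed
  next
    case 2
    then obtain d' where d: "d = Suc d'" by (cases d) auto
    have h: "nonneg_fps (?F a b c d' e)"
      using less.hyps[of a b c d' e] less.prems 2 d by simp
    have 3: "gauss (Suc b) d = gauss (Suc b) d' + X ^ d * gauss b d"
      unfolding d by simp
    show ?thesis
    proof (cases b)
      case 0
      have "?F a b c d e = ?F a b c d' e + X ^ d * gauss a (Suc c)"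
        unfolding 3 using 0 by (simp add: algebra_simps)
      then show ?thesis using h by (auto simp del: gauss.simps intro!: nonneg_fps_intros)
    next
      case (Suc b')
      have h2: "nonneg_fps (?F a b' c d (Suc e))"
        using less.hyps[of a b' c d "Suc e"] less.prems 2 Suc by simp
      have 4: "gauss b (Suc d) = gauss b d + X ^ Suc d * gauss b' (Suc d)"
        unfolding Suc by simp
      have "?F a b c d e = ?F a b c d' e + X ^ d * ?F a b' c d (Suc e)"
        unfolding 3 4 d[symmetric] Suc[symmetric] by (simp add: algebra_simps del: gauss.simps)
      then show ?thesis using h h2 by (metis nonneg_fps_intros nonneg_fps_X)
    qed
  next
    case 3
    then obtain e' where e: "e = Suc e'" by (cases e) auto
    then obtain d' where d: "d = Suc d'" using 3 by (cases d) auto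
    have h: "nonneg_fps (?F a b c d' e')"
      using less.hyps[of a b c d' e'] less.prems 3 d e by simp
    have 4: "gauss (Suc b) d = gauss b d + X ^ Suc b * gauss (Suc b) d'"
      unfolding d gauss_Suc_Suc' by simp
    show ?thesis
    proof (cases b)
      case 0
      have "?F a b c d e = gauss a (Suc c) * gauss b d + X * (?F a b c d' e')"
        unfolding 4 d[symmetric] using 0 e by (simp add: algebra_simps)
      then show ?thesis using h by (auto simp del: gauss.simps intro!: nonneg_fps_intros)
    next
      case (Suc b')
      have h2: "nonneg_fps (?F a b' c d e)"
        using less.hyps[of a b' c d e] less.prems 3 Suc by simp
      have 5: "gauss b (Suc d) = gauss b' (Suc d) + X ^ b * gauss b d"
        unfolding Suc gauss_Suc_Suc' by simp
      have "?F a b c d e = ?F a b' c d e + X ^ Suc b * ?F a b c d' e'"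
        unfolding 4 5 d[symmetric] Suc[symmetric] e by (simp add: algebra_simps del: gauss.simps)
      then show ?thesis using h h2 by (metis nonneg_fps_intros nonneg_fps_X)
    qed
  next
    case 4
    then show ?thesis by (simp del: gauss.simps)
  qed
qed

section \<open>Nonnegativity of the summands\<close>

text \<open>The inner difference is \<open>gauss (a - 1) (Suc b)\<close> for positive
  \<open>a\<close> and 0 for \<open>a = 0\<close>. Inserting a part \<open>c\<close> therefore
  proves the claim, and the form without a predecessor fits into polynomial identities that hold for
  all \<open>a\<close>.\<close>

lemma nonneg_gauss_omit_part:
  assumes "c \<le> Suc b"
  shows "nonneg_fps (gauss a (Suc b) - X ^ c * (gauss a (Suc b) - X ^ a * gauss a b))"
proof (cases a)
  case (Suc a')
  have "gauss a (Suc b) - X ^ a * gauss a b = gauss a' (Suc b)"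
    unfolding Suc gauss_Suc_Suc' by simp
  then show ?thesis using nonneg_gauss_add_part[OF assms, of a'] Suc by simp
qed simp

text \<open>
  The lemmas \<open>nonneg_site_*\<close> concern the summand with a given pair of indices after the
  rearrangement: the positive product minus all negative products that are shifted to this pair.
\<close>

lemma site_identity_1:
  fixes p g h u v x y z :: "'a :: comm_ring_1"
  assumes "p = h + x * z * u" and "g = h + x^2 * y * (g - z * h)"
  shows "p * (v + x * y * p) - x^2 * y * u * g - (v - y * u) * g =
    x * y * (p * p - x * v * g) + x * z * u * v + x^2 * y * z * h * (v - u) +
    y * u * (g - x^2 * (g - z * h))"
proof -
  \<comment> \<open>The two sides agree modulo the two assumed Pascal relations, each of which
    enters with the factor \<open>v\<close>.\<close>
  have "p * (v + x * y * p) - x^2 * y * u * g - (v - y * u) * g -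
    (x * y * (p * p - x * v * g) + x * z * u * v + x^2 * y * z * h * (v - u) +
    y * u * (g - x^2 * (g - z * h))) =
     v * (p - h - x * z * u) - v * (g - (h + x^2 * y * (g - z * h)))"
    by (simp add: algebra_simps power2_eq_square)
  also have "\<dots> = 0" using assms by simp
  finally show ?thesis by simp
qed

section \<open>Summands for positive \<open>m\<close>\<close>

lemma nonneg_site_1:
  "nonneg_fps (gauss (Suc k) (Suc b) * gauss (Suc (Suc k)) (Suc b)
     - X ^ (b + 2) * gauss (Suc k) b * gauss k (b + 2)
     - (gauss (Suc (Suc k)) b - X ^ b * gauss (Suc k) b) * gauss k (b + 2))"
proof -
  let ?p = "gauss (Suc k) (Suc b)" and ?g = "gauss k (b + 2)" and ?h = "gauss k (Suc b)"
    and ?u = "gauss (Suc k) b" and ?v = "gauss (Suc (Suc k)) b"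
  have 1: "?p = ?h + X * X ^ k * ?u"
    unfolding gauss_Suc_Suc' by simp
  have 2: "?g = ?h + X\<^sup>2 * X ^ b * (?g - X ^ k * ?h)"
  proof (cases k)
    case (Suc k')
    have "?g - X ^ k * ?h = gauss k' (b + 2)"
      unfolding Suc using gauss_Suc_Suc'[of k' "Suc b"] by simp
    then show ?thesis unfolding Suc by (simp add: power2_eq_square algebra_simps)
  qed simp
  have lc: "nonneg_fps (?p * ?p - X * ?v * ?g)"
    using gauss_log_concave[of k "Suc k" 1 b "Suc b"] by (simp del: gauss.simps)
  have om: "nonneg_fps (?g - X^2 * (?g - X ^ k * ?h))"
    using nonneg_gauss_omit_part[of 2 "Suc b" k] by (simp del: gauss.simps)
  have "gauss (Suc k) (Suc b) * gauss (Suc (Suc k)) (Suc b)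
     - X ^ (b + 2) * gauss (Suc k) b * gauss k (b + 2)
     - (gauss (Suc (Suc k)) b - X ^ b * gauss (Suc k) b) * gauss k (b + 2) =
     ?p * (?v + X * X ^ b * ?p) - X^2 * X ^ b * ?u * ?g - (?v - X ^ b * ?u) * ?g"
    by (simp add: power_add mult_ac power2_eq_square)
  also have "\<dots> = X * X ^ b * (?p * ?p - X * ?v * ?g) + X * X ^ k * ?u * ?v +
     X^2 * X ^ b * X ^ k * ?h * (?v - ?u) + X ^ b * ?u * (?g - X^2 * (?g - X ^ k * ?h))"
    by (rule site_identity_1[OF 1 2])
  finally show ?thesis
    using lc om nonneg_gauss_diff_rows by (auto simp del: gauss.simps intro!: nonneg_fps_intros)
qed

text \<open>Pascal's rule splits the larger positive factor into \<open>?s\<close> and a multiple of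
  \<open>?t\<close>. Log-concavity with \<open>e = Suc m\<close> is used against \<open>?s\<close>,
  and again against the portion \<open>X ^ b * ?d\<close> of \<open>?t\<close>; inserting or
  omitting a part handles what is left.\<close>

lemma nonneg_site_ge2:
  "nonneg_fps (gauss (Suc k) (Suc b) * gauss (Suc (Suc k)) (b + m + 2)
     - X ^ (b + m + 3) * gauss (Suc k) b * gauss k (b + m + 3)
     - X ^ Suc m * (gauss (Suc (Suc k)) b - X ^ b * gauss (Suc k) b) * gauss k (b + m + 3))"
proof -
  let ?p = "gauss (Suc k) (Suc b)" and ?s = "gauss (Suc k) (b + m + 2)"
    and ?t = "gauss (Suc (Suc k)) (b + m + 1)" and ?b = "gauss k (b + m + 3)"
    and ?v = "gauss (Suc (Suc k)) b" and ?u = "gauss (Suc k) b"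
    and ?c = "gauss k (b + m + 2)" and ?d = "gauss (Suc k) (b + m + 1)"
  have 1: "gauss (Suc (Suc k)) (b + m + 2) = ?s + X^2 * X ^ k * ?t"
    using gauss_Suc_Suc'[of "Suc k" "b + m + 1"] by (simp add: power2_eq_square mult_ac)
  have lc1: "nonneg_fps (?p * ?s - X * X ^ m * ?v * ?b)"
    using gauss_log_concave[of k "Suc k" "Suc m" b "b + m + 2"]
    by (simp add: eval_nat_numeral del: gauss.simps)
  have lc2: "nonneg_fps (?p * ?d - X * X ^ m * ?v * ?c)"
    using gauss_log_concave[of k "Suc k" "Suc m" b "b + m + 1"]
    by (simp add: eval_nat_numeral del: gauss.simps)
  have ad: "nonneg_fps (?t - X ^ b * ?d)"
    by (rule nonneg_gauss_add_part) simp
  have om: "nonneg_fps (?b - X^2 * (?b - X ^ k * ?c))"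
    using nonneg_gauss_omit_part[of 2 "b + m + 2" k] by (simp add: eval_nat_numeral del: gauss.simps)
  have "gauss (Suc k) (Suc b) * gauss (Suc (Suc k)) (b + m + 2)
     - X ^ (b + m + 3) * gauss (Suc k) b * gauss k (b + m + 3)
     - X ^ Suc m * (gauss (Suc (Suc k)) b - X ^ b * gauss (Suc k) b) * gauss k (b + m + 3) =
     (?p * ?s - X * X ^ m * ?v * ?b) + X^2 * X ^ k * ?p * (?t - X ^ b * ?d) +
     X^2 * X ^ k * X ^ b * (?p * ?d - X * X ^ m * ?v * ?c) +
     X^3 * X ^ k * X ^ b * X ^ m * ?c * (?v - ?u) +
     X * X ^ b * X ^ m * ?u * (?b - X^2 * (?b - X ^ k * ?c))"
    unfolding 1 by (simp del: gauss.simps add: power_add algebra_simps eval_nat_numeral)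
  then show ?thesis
    using lc1 lc2 ad om nonneg_gauss_diff_rows
    by (auto simp del: gauss.simps intro!: nonneg_fps_intros)
qed

lemma nonneg_site_pos:
  assumes "1 \<le> m"
  shows "nonneg_fps (gauss (Suc k) (Suc b) * gauss (Suc (Suc k)) (b + m)
     - X ^ (b + m + 1) * gauss (Suc k) b * gauss k (b + m + 1)
     - X ^ (m - 1) * (gauss (Suc (Suc k)) b - X ^ b * gauss (Suc k) b) * gauss k (b + m + 1))"
proof (cases "m = 1")
  case True
  \<comment> \<open>The decomposition for larger \<open>m\<close> uses log-concavity with
    \<open>e = m - 1\<close>. Here that is 0, which violates \<open>a <= e + b\<close> for
    \<open>a = Suc k\<close> and \<open>b = k\<close>, so a different identity is used, with
    log-concavity at \<open>e = 1\<close>.\<close>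
  then show ?thesis using nonneg_site_1[of k b] by (simp del: gauss.simps)
next
  case False
  with assms have "2 \<le> m" by simp
  then obtain m' where "m = m' + 2" using le_Suc_ex by (metis add.commute)
  then show ?thesis using nonneg_site_ge2[of k b m'] by (simp add: eval_nat_numeral del: gauss.simps)
qed


section \<open>Partitions without parts equal to 1\<close>

fun no_ones :: "nat \<Rightarrow> nat \<Rightarrow> int fps" where
  "no_ones 0 b = 1"
| "no_ones (Suc a) b = gauss (Suc a) b - X * gauss a b"

text \<open>For \<open>1 <= b\<close>, \<open>no_ones a b\<close> generates the partitions in the
  box that contain no part 1, since deleting one part 1 from any other leaves a box with one row
  fewer. For \<open>b = 0\<close> there is no part 1 to delete and the value \<open>1 - X\<close>
  (for positive \<open>a\<close>) has a negative coefficient; this is why column 0 is treated apart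
  later.\<close>

lemma nonneg_no_ones: "1 \<le> b \<Longrightarrow> nonneg_fps (no_ones a b)"
  using nonneg_gauss_add_part[of 1 b] by (cases a) auto

text \<open>If all \<open>Suc a\<close> parts are positive and none is 1, then 2 can be subtracted
  from each.\<close>

lemma no_ones_Suc_row:
  "no_ones (Suc a) (Suc (Suc b)) = no_ones a (Suc (Suc b)) + X ^ (2 * Suc a) * gauss (Suc a) b"
proof (cases a)
  case 0
  have "gauss (Suc 0) (Suc (Suc b)) = 1 + X + X\<^sup>2 * gauss (Suc 0) b"
    unfolding gauss_Suc_Suc' by (simp add: power2_eq_square algebra_simps)
  then show ?thesis using 0 by (simp del: gauss.simps(3) add: eval_nat_numeral)
next
  case (Suc a')
  have 1: "gauss (Suc a) (Suc (Suc b)) = gauss a (Suc (Suc b)) + X ^ Suc a * gauss (Suc a) (Suc b)"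
    "gauss a (Suc (Suc b)) = gauss a' (Suc (Suc b)) + X ^ a * gauss a (Suc b)"
    "gauss (Suc a) (Suc b) = gauss a (Suc b) + X ^ Suc a * gauss (Suc a) b"
    unfolding Suc by (rule gauss_Suc_Suc')+
  have "no_ones (Suc a) (Suc (Suc b)) - no_ones a (Suc (Suc b)) =
      (gauss (Suc a) (Suc (Suc b)) - gauss a (Suc (Suc b))) -
      X * (gauss a (Suc (Suc b)) - gauss a' (Suc (Suc b)))"
    unfolding Suc by (simp del: gauss.simps add: algebra_simps)
  also have "\<dots> = X ^ Suc a * (gauss (Suc a) (Suc b) - gauss a (Suc b))"
    using 1(1,2) by (simp del: gauss.simps add: algebra_simps)
  also have "\<dots> = X ^ (2 * Suc a) * gauss (Suc a) b"
    unfolding 1(3) mult_2 power_add by (simp del: gauss.simps power_Suc add: mult.assoc)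
  finally show ?thesis by (simp del: gauss.simps no_ones.simps add: algebra_simps)
qed

text \<open>Deleting a largest part \<open>Suc b\<close> does not affect the absence of ones because
  \<open>Suc b\<close> is at least 2.\<close>

lemma no_ones_Suc_col:
  assumes "1 \<le> b"
  shows "no_ones (Suc a) (Suc b) = no_ones (Suc a) b + X ^ Suc b * no_ones a (Suc b)"
proof -
  obtain b' where "b = Suc b'" using assms by (cases b) auto
  then show ?thesis by (cases a) (simp_all add: algebra_simps)
qed

text \<open>Inserting a part 2 is injective and creates no part 1. In the narrowest box only parts 2
  remain, and the difference is exactly 1.\<close>

lemma nonneg_no_ones_add_two:
  "nonneg_fps (no_ones (Suc a) (b + 2) - X^2 * no_ones a (b + 2))"
proof (induction "a + b" arbitrary: a b rule: less_induct)
  case less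
  show ?case
  proof (cases b)
    case 0
    have "no_ones (Suc n) 2 = no_ones n 2 + X ^ (2 * Suc n)" for n
      using no_ones_Suc_row[of n 0] by (simp add: eval_nat_numeral del: no_ones.simps)
    note row = this
    have "no_ones (Suc n) 2 - X^2 * no_ones n 2 = 1" for n
    proof (induction n)
      case 0
      then show ?case using row[of 0] by (simp del: no_ones.simps(2))
    next
      case (Suc n)
      have "no_ones (Suc (Suc n)) 2 - X^2 * no_ones (Suc n) 2 =
          (no_ones (Suc n) 2 + X ^ (2 * Suc (Suc n))) - X^2 * (no_ones n 2 + X ^ (2 * Suc n))"
        by (simp only: row)
      also have "\<dots> = no_ones (Suc n) 2 - X^2 * no_ones n 2"
        by (simp del: no_ones.simps add: algebra_simps power2_eq_square)
      finally show ?case using Suc by simp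
    qed
    then show ?thesis unfolding 0 add_0 by (simp only: nonneg_fps_1)
  next
    case (Suc b')
    have col: "no_ones (Suc n) (b + 2) = no_ones (Suc n) (b' + 2) + X ^ (b + 2) * no_ones n (b + 2)" for n
      using no_ones_Suc_col[of "b' + 2" n] Suc by (simp del: no_ones.simps)
    have IH: "nonneg_fps (no_ones (Suc a) (b' + 2) - X^2 * no_ones a (b' + 2))"
      using less[of a b'] Suc by simp
    show ?thesis
    proof (cases a)
      case 0
      have "no_ones (Suc a) (b + 2) - X^2 * no_ones a (b + 2) =
        (no_ones (Suc a) (b' + 2) - X^2 * no_ones a (b' + 2)) + X ^ (b + 2)"
        unfolding col using 0 by (simp del: no_ones.simps(2))
      then show ?thesis using IH by (auto simp del: no_ones.simps intro!: nonneg_fps_intros)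
    next
      case (Suc a')
      have IH2: "nonneg_fps (no_ones (Suc a') (b + 2) - X^2 * no_ones a' (b + 2))"
        using less[of a' b] Suc by simp
      have "no_ones (Suc a) (b + 2) - X^2 * no_ones a (b + 2) =
        (no_ones (Suc a) (b' + 2) - X^2 * no_ones a (b' + 2)) +
        X ^ (b + 2) * (no_ones (Suc a') (b + 2) - X^2 * no_ones a' (b + 2))"
        unfolding Suc col by (simp del: no_ones.simps add: algebra_simps)
      then show ?thesis using IH IH2 by (auto simp del: no_ones.simps intro!: nonneg_fps_intros)
    qed
  qed
qed

text \<open>
  In the two-variable recursions \<open>y = X ^ a\<close> and \<open>z = X ^ k\<close> turn the claim into a polynomial
  identity. All terms of the final decomposition are nonnegative; the two factors
  \<open>U * U - X * W * Z1\<close> and \<open>S * D2 - X^3 * N1 * Z3\<close> are instances of log-concavity.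
\<close>

lemma nonneg_site_0:
  fixes k a :: nat
  defines "b \<equiv> Suc (Suc a)"
  shows "nonneg_fps (gauss (Suc (Suc k)) (Suc b) * gauss (Suc (Suc (Suc k))) b
     - X ^ Suc b * gauss (Suc (Suc k)) b * gauss (Suc k) (Suc b)
     - gauss (Suc (Suc k)) (Suc a) * gauss (Suc k) (Suc b)
     - X ^ b * no_ones (Suc (Suc (Suc k))) (Suc a) * gauss k (Suc b)
     - X ^ (2 * b + 3) * no_ones (Suc (Suc k)) b * gauss k (Suc b))"
proof -
  define P where "P = gauss (Suc (Suc k)) (Suc b)"
  define V where "V = gauss (Suc (Suc (Suc k))) b"
  define U where "U = gauss (Suc (Suc k)) b"
  define W where "W = gauss (Suc k) (Suc b)"
  define Y where "Y = gauss (Suc (Suc k)) (Suc a)"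
  define N1 where "N1 = gauss k (Suc b)"
  define S where "S = gauss (Suc k) b"
  define R where "R = gauss k b"
  define Z1 where "Z1 = gauss (Suc (Suc (Suc k))) (Suc a)"
  define Z2 where "Z2 = gauss (Suc (Suc (Suc k))) a"
  \<comment> \<open>This is \<open>Z2\<close> with one column fewer; the value 0 at
    \<open>a = 0\<close> keeps the recursion \<open>r3\<close> valid there.\<close>
  define Z3 where "Z3 = (if a = 0 then 0 else gauss (Suc (Suc (Suc k))) (a - 1))"
  define D2 where "D2 = gauss (Suc (Suc k)) a"
  define Q1 where "Q1 = gauss (Suc k) (Suc a)"
  define Hp where "Hp = no_ones (Suc (Suc (Suc k))) (Suc a)"
  define H0 where "H0 = no_ones (Suc (Suc k)) b"
  define H1 where "H1 = no_ones (Suc k) b"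
  define N3 where "N3 = N1 - X ^ 3 * (N1 - X ^ k * R)"
  define y where "y = X ^ a"
  define z where "z = X ^ k"
  note defs = P_def V_def U_def W_def Y_def N1_def S_def R_def Z1_def Z2_def D2_def Q1_def
    Hp_def H0_def H1_def
  have r1: "V = Z1 + X^2 * y * U" and r2: "Z1 = Y + X^3 * z * Z2"
    and r4: "P = W + X^2 * z * U" and r6: "W = N1 + X * z * S"
    and r7: "U = Y + X^2 * y * S" and r8: "U = S + X^2 * z * Y" and r9: "Y = Q1 + X^2 * z * D2"
    and r10: "S = R + X * z * Q1" and r11: "S = Q1 + X^2 * y * R"
    and r5: "W = S + X^3 * y * N1" and r12: "Z1 = Z2 + X * y * Y"
    using gauss_Suc_Suc'[of "Suc (Suc k)" a] gauss_Suc_Suc'[of "Suc k" b]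
      gauss_Suc_Suc'[of k b] gauss_Suc_Suc'[of "Suc k" "Suc a"] gauss_Suc_Suc'[of "Suc k" a]
      gauss_Suc_Suc'[of k "Suc a"]
    unfolding defs y_def z_def b_def
    by (simp_all only: gauss.simps(3)[of "Suc (Suc k)" "Suc a"] gauss.simps(3)[of "Suc k" "Suc a"]
        gauss.simps(3)[of "k" "Suc a"] gauss.simps(3)[of "k" "Suc (Suc a)"]
        gauss.simps(3)[of "Suc (Suc k)" a] power_Suc power2_eq_square power3_eq_cube mult_ac)
  have r3: "Z2 = D2 + X^3 * z * Z3"
  proof (cases a)
    case (Suc a')
    then show ?thesis using gauss_Suc_Suc'[of "Suc (Suc k)" a']
      unfolding Z2_def D2_def Z3_def z_def by (simp del: gauss.simps add: power3_eq_cube mult_ac)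
  qed (simp add: Z2_def D2_def Z3_def)
  have h: "Hp = Z1 - X * Y" "H0 = U - X * S" "H1 = S - X * R"
    unfolding defs by simp_all
  have A: "P * V - X^3 * y * U * W - Y * W =
      X^2 * z * U * V + X^3 * z * W * Z2 - X^5 * y * z * W * Y + X^2 * y * W * H0"
  proof -
    have "V - Y - X^3 * y * U = X^3 * z * Z2 + X^2 * y * H0 - X^5 * y * z * Y"
      unfolding r1 r2 h(2) by (subst (2) r8) (simp add: algebra_simps eval_nat_numeral)
    then have "W * (V - Y - X^3 * y * U) = W * (X^3 * z * Z2 + X^2 * y * H0 - X^5 * y * z * Y)"
      by simp
    then show ?thesis unfolding r4 by (simp add: algebra_simps)
  qed
  \<comment> \<open>Subtracting \<open>X^2 * y * H1\<close> forbids the part \<open>b\<close>; the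
    last term adds the partitions with exactly \<open>k + 3\<close> parts, from each of which 2 is
    subtracted.\<close>
  have hp: "Hp = H0 - X^2 * y * H1 + X^6 * z^2 * Z3"
  proof -
    have "H0 - X^2 * y * H1 = Y - X * Q1"
      unfolding h(3) unfolding h(2) r7 r11 by (simp add: algebra_simps)
    note a1 = this
    have a2: "Hp - (Y - X * Q1) = X^3 * z * (Z2 - D2)"
      unfolding h(1) r2 by (subst (2) r9) (simp add: algebra_simps eval_nat_numeral)
    have a3: "Z2 - D2 = X^3 * z * Z3" using r3 by simp
    have "Hp = (Y - X * Q1) + X^3 * z * (X^3 * z * Z3)" using a2 unfolding a3 by (simp add: diff_eq_eq)
    also have "\<dots> = H0 - X^2 * y * H1 + X^6 * z^2 * Z3"
      unfolding a1[symmetric] by (simp add: algebra_simps eval_nat_numeral)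
    finally show ?thesis .
  qed
  have h01: "H0 = H1 + X^4 * z^2 * D2"
  proof -
    have "H0 - H1 = X^2 * z * (Y - Q1)"
      unfolding h(2,3) by (subst r8, subst (2) r10) (simp add: algebra_simps eval_nat_numeral)
    then show ?thesis unfolding r9 by (simp add: algebra_simps eval_nat_numeral)
  qed
  have n3: "N1 - X^3 * N1 = N3 - X^3 * z * R"
    unfolding N3_def z_def by (simp add: algebra_simps)
  have B: "W * H0 - N1 * Hp - X^5 * y * N1 * H0 =
    X * z * S * H0 - X^6 * z^2 * N1 * Z3 + X^2 * y * (N3 * H1 - X^3 * z * R * H1 - X^7 * z^2 * N1 * D2)"
  proof -
    have "W * H0 - N1 * Hp - X^5 * y * N1 * H0 =
      X * z * S * H0 - X^6 * z^2 * N1 * Z3 + X^2 * y * ((N1 - X^3 * N1) * H1 - X^3 * N1 * (H0 - H1))"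
      unfolding hp r6 by (simp add: algebra_simps eval_nat_numeral)
    also have "(N1 - X^3 * N1) * H1 - X^3 * N1 * (H0 - H1) =
        N3 * H1 - X^3 * z * R * H1 - X^7 * z^2 * N1 * D2"
      unfolding n3 h01 by (simp add: algebra_simps eval_nat_numeral)
    finally show ?thesis .
  qed
  \<comment> \<open>Writing \<open>Y\<close> as \<open>Z1 - X^3 * z * Z2\<close> produces the
    log-concave pair \<open>U * U - X * W * Z1\<close>. The released
    \<open>X^6 * y * z * W * Z2\<close> compensates the negative term with \<open>N1 * D2\<close>
    through \<open>D\<close>.\<close>
  have C: "U * V - X^3 * y * W * Y + X^6 * y * z * W * Z2 - X^6 * y * z * W * Z2 =
     X^2 * y * (U * U - X * W * Z1) + U * Z1 + X^6 * y * z * W * Z2"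
    unfolding r1 unfolding r2 by (simp add: algebra_simps eval_nat_numeral)
  have D: "W * Z2 - X^3 * y * N1 * D2 = X^3 * z * W * Z3 + S * D2"
    unfolding r3 using r5 by (simp add: algebra_simps eval_nat_numeral)
  \<comment> \<open>\<open>U * Z1\<close> is expanded just far enough to release
    \<open>X^3 * y * z * S * D2\<close>, which \<open>lc2\<close> sets against the remaining
    negative term with \<open>N1 * Z3\<close>.\<close>
  have E: "U * Z1 = X^3 * y * z * S * D2 + X^2 * z * Y * Z1 + S * Z2 + X * y * S * Q1"
  proof -
    have "U * Z1 = X^2 * z * Y * Z1 + S * Z1" unfolding r8 by (simp add: algebra_simps)
    also have "S * Z1 = S * Z2 + X * y * S * Y" unfolding r12 by (simp add: algebra_simps)
    also have "X * y * S * Y = X * y * S * Q1 + X^3 * y * z * S * D2" unfolding r9 by (simp add: algebra_simps eval_nat_numeral)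
    finally show ?thesis by (simp add: algebra_simps eval_nat_numeral)
  qed
  have F: "S * H0 - X^4 * y * R * H1 = Q1 * H0 + X^2 * y * R * (H0 - X^2 * H1)"
    unfolding r11 by (simp add: algebra_simps eval_nat_numeral)
  have lc1: "nonneg_fps (U * U - X * W * Z1)"
    using gauss_log_concave[of "Suc k" "Suc (Suc k)" 1 "Suc a" b]
    unfolding U_def W_def Z1_def b_def by (simp del: gauss.simps add: mult_ac)
  have lc2: "nonneg_fps (S * D2 - X^3 * N1 * Z3)"
  proof (cases a)
    case 0
    then show ?thesis by (simp add: Z3_def S_def D2_def)
  next
    case (Suc a')
    then show ?thesis
      using gauss_log_concave[of k "Suc (Suc k)" 3 a' b]
      unfolding S_def D2_def N1_def Z3_def b_def by (simp del: gauss.simps add: mult_ac)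
  qed
  have n3': "nonneg_fps N3"
    unfolding N3_def N1_def R_def by (rule nonneg_gauss_omit_part) (simp add: b_def)
  have h': "nonneg_fps H0" "nonneg_fps H1"
    unfolding H0_def H1_def b_def by (rule nonneg_no_ones; simp)+
  have h2: "nonneg_fps (H0 - X^2 * H1)"
    unfolding H0_def H1_def b_def using nonneg_no_ones_add_two[of "Suc k" a] by (simp del: no_ones.simps)
  have pos: "nonneg_fps U" "nonneg_fps W" "nonneg_fps S" "nonneg_fps Z2" "nonneg_fps Z3"
    "nonneg_fps D2" "nonneg_fps Y" "nonneg_fps Z1" "nonneg_fps Q1" "nonneg_fps R"
    "nonneg_fps y" "nonneg_fps z"
    unfolding defs Z3_def y_def z_def by (auto simp del: gauss.simps intro!: nonneg_fps_intros)
  have "P * V - X^3 * y * U * W - Y * W - X^2 * y * Hp * N1 - X^7 * y^2 * H0 * N1 =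
     X^2 * z * U * V + X^3 * z * W * Z2 - X^5 * y * z * W * Y +
     X^2 * y * (W * H0 - N1 * Hp - X^5 * y * N1 * H0)"
    using A by (simp add: algebra_simps eval_nat_numeral)
  also have "\<dots> = X^2 * z * ((U * V - X^3 * y * W * Y + X^6 * y * z * W * Z2 - X^6 * y * z * W * Z2)
       + X * W * Z2 + X * y * (S * H0 - X^4 * y * R * H1)
       - X^6 * y * z * N1 * Z3 - X^9 * y^2 * z * N1 * D2) + X^4 * y^2 * N3 * H1"
    unfolding B by (simp add: algebra_simps eval_nat_numeral)
  also have "\<dots> = X^2 * z * (X^2 * y * (U * U - X * W * Z1) + U * Z1 - X^6 * y * z * N1 * Z3
       + X^6 * y * z * (W * Z2 - X^3 * y * N1 * D2)
       + X * W * Z2 + X * y * (S * H0 - X^4 * y * R * H1)) + X^4 * y^2 * N3 * H1"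
    unfolding C by (simp add: algebra_simps eval_nat_numeral)
  also have "\<dots> = X^2 * z * (X^2 * y * (U * U - X * W * Z1)
       + X^3 * y * z * (S * D2 - X^3 * N1 * Z3) + X^2 * z * Y * Z1 + S * Z2 + X * y * S * Q1
       + X^6 * y * z * (X^3 * z * W * Z3 + S * D2)
       + X * W * Z2 + X * y * (Q1 * H0 + X^2 * y * R * (H0 - X^2 * H1))) + X^4 * y^2 * N3 * H1"
    unfolding D E F by (simp add: algebra_simps eval_nat_numeral)
  finally have "nonneg_fps (P * V - X^3 * y * U * W - Y * W - X^2 * y * Hp * N1 - X^7 * y^2 * H0 * N1)"
    by (simp only:) (intro nonneg_fps_intros pos lc1 lc2 n3' h' h2 nonneg_fps_X)
  moreover have "P * V - X^3 * y * U * W - Y * W - X^2 * y * Hp * N1 - X^7 * y^2 * H0 * N1 =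
     P * V - X ^ Suc b * U * W - Y * W - X ^ b * Hp * N1 - X ^ (2 * b + 3) * H0 * N1"
    unfolding y_def b_def by (simp add: power_add eval_nat_numeral mult_ac flip: power_mult)
  ultimately have "nonneg_fps (P * V - X ^ Suc b * U * W - Y * W - X ^ b * Hp * N1 - X ^ (2 * b + 3) * H0 * N1)"
    by (simp only:)
  then show ?thesis unfolding defs .
qed

section \<open>Boundary summands for \<open>m = 0\<close>: column 1 and row 1\<close>

lemma gauss_one_mult: "gauss (Suc n) 1 * gauss n 1 = (1 + X) * gauss n 2"
proof (induction n)
  case 0
  then show ?case by (simp add: eval_nat_numeral)
next
  case (Suc n)
  have 1: "gauss (Suc n) 2 = gauss n 2 + X ^ Suc n * gauss (Suc n) 1"
    "gauss (Suc n) 1 = gauss n 1 + X ^ Suc n"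
    "gauss (Suc (Suc n)) 1 = gauss (Suc n) 1 + X * X ^ Suc n"
    using gauss_Suc_Suc'[of n 1] gauss_Suc_Suc'[of n 0] gauss_Suc_Suc'[of "Suc n" 0]
    by (simp_all add: eval_nat_numeral del: gauss.simps)
  have "(1 + X) * gauss (Suc n) 2 = gauss (Suc n) 1 * gauss n 1 + (1 + X) * X ^ Suc n * gauss (Suc n) 1"
    unfolding 1(1) Suc by (simp add: algebra_simps del: gauss.simps power_Suc)
  also have "\<dots> = gauss (Suc n) 1 * (gauss n 1 + X ^ Suc n + X * X ^ Suc n)"
    by (simp add: algebra_simps del: gauss.simps power_Suc)
  also have "\<dots> = gauss (Suc n) 1 * gauss (Suc (Suc n)) 1"
    unfolding 1(3) by (subst (3) 1(2)) (simp del: gauss.simps)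
  finally show ?case by (simp add: mult.commute del: gauss.simps)
qed

text \<open>The factor \<open>X ^ 5\<close> would be paid by inserting parts 2, 2 and 1, which needs
  three new rows, while only one is at hand. Hence two rows are first split off
  \<open>gauss k 2\<close>, and the two middle summands absorb the split-off terms. For
  \<open>k < 2\<close> there are not enough rows, and explicit polynomials are compared.\<close>

lemma nonneg_gauss_two_aux:
  "nonneg_fps (gauss (Suc k) 2 + X ^ (k + 2) * gauss (Suc (Suc k)) 1 + X ^ (k + 5) * gauss (Suc k) 2
     - X ^ 5 * gauss k 2)"
proof -
  consider "k = 0" | "k = 1" | l where "k = Suc (Suc l)"
    by (metis One_nat_def not0_implies_Suc)
  then show ?thesis
  proof cases
    case 1
    have "gauss 1 2 = 1 + X + X^2" by (simp add: eval_nat_numeral)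
    then have "gauss (Suc k) 2 + X ^ (k + 2) * gauss (Suc (Suc k)) 1 + X ^ (k + 5) * gauss (Suc k) 2
       - X ^ 5 * gauss k 2 = gauss 1 2 + X ^ 2 * gauss 2 1 + X^6 + X^7"
      using 1 by (simp add: algebra_simps eval_nat_numeral del: gauss.simps(2,3))
    then show ?thesis by (auto simp del: gauss.simps intro!: nonneg_fps_intros)
  next
    case 2
    have "gauss 3 1 = 1 + X + X^2 + X^3" "gauss 1 2 = 1 + X + X^2" "gauss 2 2 = 1 + X + 2 * X^2 + X^3 + X^4"
      by (simp_all add: eval_nat_numeral algebra_simps)
    then have "gauss (Suc k) 2 + X ^ (k + 2) * gauss (Suc (Suc k)) 1 + X ^ (k + 5) * gauss (Suc k) 2
       - X ^ 5 * gauss k 2 = gauss 2 2 + X^3 + X^4 + X^6 + X^8 + X^8 + X^9 + X^10"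
      using 2 by (simp add: algebra_simps eval_nat_numeral del: gauss.simps)
    then show ?thesis by (simp only:) (intro nonneg_fps_intros nonneg_fps_X nonneg_gauss)
  next
    case 3
    define y where "y = X ^ l"
    have 1: "gauss k 2 = gauss l 2 + X * y * gauss (Suc l) 1 + X^2 * y * gauss (l + 2) 1"
      "gauss (Suc (Suc k)) 1 = 1 + X * (1 + X * gauss (l + 2) 1)"
      using gauss_Suc_Suc'[of l 1] gauss_Suc_Suc'[of "Suc l" 1] 3
      by (simp_all add: eval_nat_numeral y_def mult_ac del: gauss.simps) simp
    \<comment> \<open>Telescoping over the insertions of parts 2, 2 and 1.\<close>
    have "gauss (l + 3) 2 - X^5 * gauss l 2 = (gauss (l + 3) 2 - X^2 * gauss (l + 2) 2) +
      X^2 * (gauss (l + 2) 2 - X^2 * gauss (l + 1) 2) + X^4 * (gauss (l + 1) 2 - X^1 * gauss l 2)"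
      by (simp add: algebra_simps eval_nat_numeral del: gauss.simps)
    moreover have "nonneg_fps \<dots>"
      using nonneg_gauss_add_part[of 2 2 "l + 2"] nonneg_gauss_add_part[of 2 2 "l + 1"]
        nonneg_gauss_add_part[of 1 2 l]
      by (intro nonneg_fps_intros nonneg_fps_X) (simp_all add: eval_nat_numeral del: gauss.simps)
    ultimately have a: "nonneg_fps (gauss (l + 3) 2 - X^5 * gauss l 2)" by (simp only:)
    have b: "nonneg_fps (gauss (l + 2) 1 - gauss (Suc l) 1)"
      using nonneg_gauss_diff_rows[of "Suc l" 1] by simp
    have "gauss (l + 3) 2 - gauss (l + 2) 1 = (gauss (l + 3) 2 - gauss (l + 2) 2) + (gauss (l + 2) 2 - gauss (l + 2) 1)"
      by simp
    moreover have "nonneg_fps \<dots>"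
      using nonneg_gauss_diff_rows[of "l + 2" 2] nonneg_gauss_diff_cols[of "l + 2" 1]
      by (intro nonneg_fps_intros) (simp_all add: eval_nat_numeral del: gauss.simps)
    ultimately have c: "nonneg_fps (gauss (l + 3) 2 - gauss (l + 2) 1)" by (simp only:)
    have e: "gauss (Suc k) 2 = gauss (l + 3) 2" using 3 by (simp add: eval_nat_numeral del: gauss.simps)
    have "gauss (Suc k) 2 + X ^ (k + 2) * gauss (Suc (Suc k)) 1 + X ^ (k + 5) * gauss (Suc k) 2
      - X ^ 5 * gauss k 2 = (gauss (l + 3) 2 - X^5 * gauss l 2) +
      X^4 * y * (1 + X + X^2 * (gauss (l + 2) 1 - gauss (Suc l) 1)) +
      X^7 * y * (gauss (l + 3) 2 - gauss (l + 2) 1)"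
      unfolding e 1 y_def by (simp add: 3 algebra_simps eval_nat_numeral del: gauss.simps)
    moreover have "nonneg_fps \<dots>"
      unfolding y_def using a b c by (intro nonneg_fps_intros nonneg_fps_X nonneg_fps_1)
    ultimately show ?thesis by (simp only:)
  qed
qed

lemma nonneg_site_0_col_1:
  "nonneg_fps (gauss (Suc (Suc k)) 2 * gauss (Suc (Suc (Suc k))) 1
     - X^2 * gauss (Suc (Suc k)) 1 * gauss (Suc k) 2 - X * gauss (Suc (Suc k)) 2 - X^5 * gauss k 2)"
proof -
  define y where "y = X ^ k"
  let ?g = "gauss (Suc k) 2" and ?u = "gauss (Suc (Suc k)) 1" and ?s = "gauss (Suc k) 1"
  have 1: "gauss (Suc (Suc k)) 2 = ?g + X^2 * y * ?u"
    using gauss_Suc_Suc'[of "Suc k" 1] by (simp add: eval_nat_numeral y_def mult_ac del: gauss.simps)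
  have 2: "gauss (Suc (Suc (Suc k))) 1 = 1 + X * ?u" "?u = 1 + X * ?s" by simp_all
  have 3: "?u = ?s + X^2 * y"
    using gauss_Suc_Suc'[of "Suc k" 0] by (simp add: eval_nat_numeral y_def mult_ac del: gauss.simps)
  \<comment> \<open>The product formula for a q-binomial coefficient over 2, cleared of the
    denominator \<open>1 + X\<close>.\<close>
  have 4: "?u * ?s = (1 + X) * ?g" by (rule gauss_one_mult)
  have "gauss (Suc (Suc k)) 2 * gauss (Suc (Suc (Suc k))) 1
     - X^2 * ?u * ?g - X * gauss (Suc (Suc k)) 2 =
     gauss (Suc (Suc k)) 2 * (1 + X * (?u - 1)) - X^2 * ?u * ?g"
    unfolding 2(1) by (simp add: algebra_simps del: gauss.simps)
  also have "?u - 1 = X * ?s" using 2(2) by simp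
  also have "gauss (Suc (Suc k)) 2 * (1 + X * (X * ?s)) - X^2 * ?u * ?g =
     ?g + X^2 * y * ?u + X^4 * y * (?u * ?s) - X^2 * ?g * (?u - ?s)"
    unfolding 1 by (simp add: algebra_simps eval_nat_numeral del: gauss.simps)
  also have "?u - ?s = X^2 * y" using 3 by simp
  also have "?g + X^2 * y * ?u + X^4 * y * (?u * ?s) - X^2 * ?g * (X^2 * y) =
     ?g + X^2 * y * ?u + X^5 * y * ?g"
    unfolding 4 by (simp add: algebra_simps eval_nat_numeral del: gauss.simps)
  finally have "gauss (Suc (Suc k)) 2 * gauss (Suc (Suc (Suc k))) 1
     - X^2 * ?u * ?g - X * gauss (Suc (Suc k)) 2 - X^5 * gauss k 2 =
     ?g + X ^ (k + 2) * ?u + X ^ (k + 5) * ?g - X^5 * gauss k 2"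
    by (simp add: y_def power_add power2_eq_square mult_ac del: gauss.simps)
  then show ?thesis using nonneg_gauss_two_aux[of k] by (simp only:)
qed

lemma nonneg_site_0_row_1:
  "nonneg_fps (gauss 1 (b + 2) * gauss 2 (b + 1) - X ^ (b + 2) * gauss 1 (b + 1) - gauss 1 b)"
proof -
  define u v w y where "u = gauss 1 b" and "v = gauss 1 (b + 1)" and "w = gauss 2 (b + 1)"
    and "y = X ^ b"
  have 1: "v = u + X * y" "gauss 1 (b + 2) = v + X^2 * y"
    by (simp_all add: u_def v_def y_def power2_eq_square mult_ac)
  have "nonneg_fps (w - v)" "nonneg_fps (u - 1)"
    using nonneg_gauss_diff_rows[of 1 "b + 1"] nonneg_gauss_diff_rows[of 0 b]
    by (simp_all add: u_def v_def w_def eval_nat_numeral del: gauss.simps(2,3))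
  moreover have "nonneg_fps w" "nonneg_fps y"
    by (auto simp: w_def y_def simp del: gauss.simps intro!: nonneg_fps_intros)
  moreover have "gauss 1 (b + 2) * w - X ^ (b + 2) * v - u =
      (u - 1) * w + (w - v) + X * y + X * y * w + X^2 * y * (w - v)"
    unfolding 1(2) by (simp add: 1(1) y_def algebra_simps power2_eq_square)
  ultimately have "nonneg_fps (gauss 1 (b + 2) * w - X ^ (b + 2) * v - u)"
    by (simp only:) (intro nonneg_fps_intros nonneg_fps_X)
  then show ?thesis unfolding u_def v_def w_def .
qed

section \<open>Rearrangement of the double sums\<close>

text \<open>Double series are only ever evaluated at the coefficient of \<open>X ^ n\<close>, to which only the
  indices up to \<open>n\<close> contribute when the family is \<open>graded\<close>.\<close>

definition graded :: "(nat \<Rightarrow> nat \<Rightarrow> int fps) \<Rightarrow> bool" where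
  "graded F \<longleftrightarrow> (\<forall>i j n. n < i \<or> n < j \<longrightarrow> fps_nth (F i j) n = 0)"

definition dsum :: "(nat \<Rightarrow> nat \<Rightarrow> int fps) \<Rightarrow> nat \<Rightarrow> int" where
  "dsum F n = (\<Sum>i\<le>n. \<Sum>j\<le>n. fps_nth (F i j) n)"

section \<open>Linearity and index shifts of truncated double series\<close>

lemma graded_X_power:
  "(\<And>i j. i \<le> e i j \<and> j \<le> e i j) \<Longrightarrow> graded (\<lambda>i j. X ^ e i j * F i j)"
  unfolding graded_def fps_X_power_mult_nth by (auto dest: le_less_trans) (metis le_trans not_le)+

lemma graded_shift_left: "graded F \<Longrightarrow> graded (\<lambda>i j. F (Suc i) j)"
  unfolding graded_def by (meson less_SucI)

lemma graded_shift_right: "graded F \<Longrightarrow> graded (\<lambda>i j. F i (Suc j))"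
  unfolding graded_def by (meson less_SucI)

lemma dsum_cong: "(\<And>i j. F i j = G i j) \<Longrightarrow> dsum F n = dsum G n"
  unfolding dsum_def by simp

lemma dsum_add: "dsum (\<lambda>i j. F i j + G i j) n = dsum F n + dsum G n"
  by (simp add: dsum_def sum.distrib)

lemma dsum_diff: "dsum (\<lambda>i j. F i j - G i j) n = dsum F n - dsum G n"
  by (simp add: dsum_def sum_subtractf)

lemma dsum_nonneg: "(\<And>i j. nonneg_fps (F i j)) \<Longrightarrow> 0 \<le> dsum F n"
  unfolding dsum_def nonneg_fps_def by (auto intro!: sum_nonneg)

lemma sum_shift_atMost:
  fixes f :: "nat \<Rightarrow> int"
  assumes "f (Suc n) = 0"
  shows "(\<Sum>i\<le>n. f i) = f 0 + (\<Sum>i\<le>n. f (Suc i))"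
  using sum.atMost_Suc_shift[of f n] assms by simp

lemma dsum_shift_left:
  assumes "graded F"
  shows "dsum F n = (\<Sum>j\<le>n. fps_nth (F 0 j) n) + dsum (\<lambda>i j. F (Suc i) j) n"
proof -
  have "fps_nth (F (Suc n) j) n = 0" for j
    using assms by (simp add: graded_def)
  then show ?thesis
    unfolding dsum_def by (intro sum_shift_atMost) simp
qed

lemma dsum_shift_right:
  assumes "graded F"
  shows "dsum F n = (\<Sum>i\<le>n. fps_nth (F i 0) n) + dsum (\<lambda>i j. F i (Suc j)) n"
proof -
  have "(\<Sum>j\<le>n. fps_nth (F i j) n) = fps_nth (F i 0) n + (\<Sum>j\<le>n. fps_nth (F i (Suc j)) n)" for i
    using assms by (intro sum_shift_atMost) (simp add: graded_def)
  then show ?thesis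
    unfolding dsum_def by (simp add: sum.distrib)
qed

lemma dsum_shift_left_0:
  "graded F \<Longrightarrow> (\<And>j. F 0 j = 0) \<Longrightarrow> dsum F n = dsum (\<lambda>i j. F (Suc i) j) n"
  by (simp add: dsum_shift_left)

lemma dsum_shift_right_0:
  "graded F \<Longrightarrow> (\<And>i. F i 0 = 0) \<Longrightarrow> dsum F n = dsum (\<lambda>i j. F i (Suc j)) n"
  by (simp add: dsum_shift_right)

lemma dsum_shift_left_ge:
  "graded F \<Longrightarrow> (\<And>j. nonneg_fps (F 0 j)) \<Longrightarrow> dsum (\<lambda>i j. F (Suc i) j) n \<le> dsum F n"
  by (auto simp: dsum_shift_left nonneg_fps_def intro!: sum_nonneg)

lemma dsum_shift_right_ge:
  "graded F \<Longrightarrow> (\<And>i. nonneg_fps (F i 0)) \<Longrightarrow> dsum (\<lambda>i j. F i (Suc j)) n \<le> dsum F n"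
  by (auto simp: dsum_shift_right nonneg_fps_def intro!: sum_nonneg)

section \<open>Shifting indices until a comparison summand by summand is possible\<close>

definition weight :: "nat \<Rightarrow> nat \<Rightarrow> nat \<Rightarrow> nat" where
  "weight m b k = (b + 2) * (b + 2 + m) + b + 2 * k + 3"

lemma weight_ge: "b \<le> weight m b k" "k \<le> weight m b k"
  by (simp_all add: weight_def)

text \<open>Pascal's rule is applied to the first factor of the positive series and to the second
  factor of the negative one. After a shift in \<open>i\<close>, \<open>P1\<close> covers
  \<open>Q1\<close> with surplus \<open>R\<close>; after shifts in both indices, \<open>P2\<close>
  covers \<open>Q2\<close> up to the deficit \<open>S\<close>. In column 0, \<open>R\<close> is
  nonnegative and \<open>S\<close> vanishes, so the result starts at
  \<open>a = Suc b\<close>.\<close>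

lemma dsum_reduction:
  "dsum (\<lambda>a i. X ^ ((a + 1) * (a + 1 + m) + i) * (gauss i a * gauss i (a + m))) n
   - dsum (\<lambda>a i. X ^ ((a + 1) * (a + 1 + m) + a + 1 + i) * (gauss i a * gauss i (a + m + 1))) n
   \<ge> dsum (\<lambda>b k. X ^ weight m b k * (gauss k (b + 1) * gauss (Suc k) (b + m))) n
     - dsum (\<lambda>b k. X ^ (weight m b (Suc k) + b + m + 1) * (gauss (Suc k) b * gauss k (b + m + 2))) n"
proof -
  define T where "T a = (a + 1) * (a + 1 + m)" for a
  define P where "P a i = X ^ (T a + i) * (gauss i a * gauss i (a + m))" for a i
  define Q where "Q a i = X ^ (T a + a + 1 + i) * (gauss i a * gauss i (a + m + 1))" for a i
  define Q1 where "Q1 a i = X ^ (T a + a + 1 + i) * (gauss i a * gauss i (a + m))" for a i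
  define Q2 where "Q2 a i = X ^ (T a + i) * (X ^ (a + 1) * gauss i a * (gauss i (a + m + 1) - gauss i (a + m)))" for a i
  \<comment> \<open>\<open>P1\<close> carries the lists of length \<open>i\<close> whose largest
    entry is \<open>a\<close>, and \<open>P2\<close> the remaining ones; the \<open>case\<close>
    covers the empty list.\<close>
  define P1 where "P1 a i = X ^ (T a + i) * ((case i of 0 \<Rightarrow> 0 | Suc i' \<Rightarrow> X ^ a * gauss i' a) * gauss i (a + m))" for a i
  define P2 where "P2 a i = X ^ (T a + i) * ((gauss i a - (case i of 0 \<Rightarrow> 0 | Suc i' \<Rightarrow> X ^ a * gauss i' a)) * gauss i (a + m))" for a i
  define R where "R a i = X ^ (T a + a + 1 + i) * (gauss i a * (gauss (Suc i) (a + m) - gauss i (a + m)))" for a i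
  define S where "S a i = X ^ (T (Suc a) + i) * ((gauss (Suc i) a - gauss i a) * gauss i (a + m + 1))" for a i
  have T: "a \<le> T a" for a by (simp add: T_def)
  have TS: "T (Suc a) = T a + 2 * a + m + 3" for a by (simp add: T_def algebra_simps)
  have grP1: "graded P1" and grP2: "graded P2" and grQ2: "graded Q2" and grR: "graded R"
    and grS: "graded S"
    unfolding P1_def P2_def Q2_def R_def S_def
    by (rule graded_X_power; use T TS in \<open>auto intro: le_trans trans_le_add1\<close>)+
  have "dsum P n = dsum (\<lambda>a i. P1 a i + P2 a i) n"
    by (rule arg_cong[where f = "\<lambda>F. dsum F n"], intro ext) (simp add: P_def P1_def P2_def algebra_simps)
  then have P: "dsum P n = dsum P1 n + dsum P2 n" by (simp add: dsum_add)
  have "dsum Q n = dsum (\<lambda>a i. Q1 a i + Q2 a i) n"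
    by (rule arg_cong[where f = "\<lambda>F. dsum F n"], intro ext) (simp add: Q_def Q1_def Q2_def power_add algebra_simps)
  then have Q: "dsum Q n = dsum Q1 n + dsum Q2 n" by (simp add: dsum_add)
  have "dsum P1 n - dsum Q1 n = dsum (\<lambda>a i. P1 a (Suc i)) n - dsum Q1 n"
    using dsum_shift_right_0[OF grP1] by (simp add: P1_def)
  also have "\<dots> = dsum R n"
    unfolding dsum_diff[symmetric]
    by (rule arg_cong[where f = "\<lambda>F. dsum F n"], intro ext)
      (simp add: P1_def Q1_def R_def power_add algebra_simps del: gauss.simps)
  finally have 1: "dsum P1 n - dsum Q1 n = dsum R n" .
  have "nonneg_fps (P2 0 i)" for i
    unfolding P2_def by (cases i) (auto simp del: gauss.simps(2,3) intro!: nonneg_fps_intros)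
  then have "dsum (\<lambda>a i. P2 (Suc a) i) n \<le> dsum P2 n"
    by (rule dsum_shift_left_ge[OF grP2])
  moreover have "dsum Q2 n = dsum (\<lambda>a i. Q2 a (Suc i)) n"
    by (rule dsum_shift_right_0[OF grQ2]) (simp add: Q2_def)
  \<comment> \<open>The area increase \<open>2 * a + m + 3\<close> of \<open>TS\<close> is the sum
    of \<open>a + 1\<close> from the explicit factor of \<open>Q2\<close>, 1 from the row shift and
    \<open>a + m + 1\<close> from Pascal's rule.\<close>
  moreover have "dsum (\<lambda>a i. Q2 a (Suc i)) n - dsum (\<lambda>a i. P2 (Suc a) i) n = dsum S n"
  proof -
    have *: "gauss i (Suc a) - (case i of 0 \<Rightarrow> 0 | Suc i' \<Rightarrow> X ^ Suc a * gauss i' (Suc a)) = gauss i a" for a i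
      by (cases i) simp_all
    have "Q2 a (Suc i) - P2 (Suc a) i = S a i" for a i
      unfolding Q2_def P2_def * unfolding S_def TS
      by (simp add: power_add algebra_simps eval_nat_numeral)
    then show ?thesis unfolding dsum_diff[symmetric] by presburger
  qed
  ultimately have 2: "dsum Q2 n - dsum P2 n \<le> dsum S n" by linarith
  have 3: "dsum (\<lambda>a i. R (Suc a) i) n \<le> dsum R n"
    by (rule dsum_shift_left_ge[OF grR])
      (auto simp: R_def simp del: gauss.simps intro!: nonneg_fps_intros nonneg_gauss_diff_rows)
  have 4: "dsum S n = dsum (\<lambda>a i. S (Suc a) i) n"
    by (rule dsum_shift_left_0[OF grS]) (simp add: S_def)
  have R: "R (Suc b) k = X ^ weight m b k * (gauss k (b + 1) * gauss (Suc k) (b + m))" for b k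
  proof -
    have "gauss (Suc k) (Suc b + m) - gauss k (Suc b + m) = X ^ Suc k * gauss (Suc k) (b + m)"
      using gauss_Suc_Suc'[of k "b + m"] by simp
    \<comment> \<open>This is the origin of \<open>weight\<close>: the exponent of \<open>R\<close>
      in column \<open>Suc b\<close> together with the power \<open>Suc k\<close> released by
      Pascal's rule.\<close>
    moreover have "T (Suc b) + Suc b + 1 + k + Suc k = weight m b k"
      by (simp add: T_def weight_def)
    ultimately show ?thesis
      unfolding R_def by (simp add: mult_ac flip: power_add power_Suc)
  qed
  have S: "S (Suc b) k = X ^ (weight m b (Suc k) + b + m + 1) * (gauss (Suc k) b * gauss k (b + m + 2))" for b k
  proof -
    have "gauss (Suc k) (Suc b) - gauss k (Suc b) = X ^ Suc k * gauss (Suc k) b"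
      using gauss_Suc_Suc'[of k "b"] by simp
    moreover have "T (Suc (Suc b)) + k + Suc k = weight m b (Suc k) + b + m + 1"
      by (simp add: T_def weight_def)
    ultimately show ?thesis
      unfolding S_def by (simp add: mult_ac flip: power_add power_Suc)
  qed
  have "dsum P n - dsum Q n \<ge> dsum (\<lambda>b k. R (Suc b) k) n - dsum (\<lambda>b k. S (Suc b) k) n"
    using P Q 1 2 3 4 by linarith
  then show ?thesis
    unfolding R S unfolding P_def Q_def T_def .
qed

text \<open>
  The second factor of each negative term is split by Pascal's rule. The first summand (\<open>stay\<close>)
  keeps its indices and the second one is shifted to the next column \<open>b + 1\<close> (\<open>up\<close>).
\<close>

lemma dsum_sites_pos:
  assumes "1 \<le> m"
  shows "dsum (\<lambda>b k. X ^ (weight m b (Suc k) + b + m + 1) * (gauss (Suc k) b * gauss k (b + m + 2))) n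
    \<le> dsum (\<lambda>b k. X ^ weight m b k * (gauss k (b + 1) * gauss (Suc k) (b + m))) n"
proof -
  define t where "t b k = X ^ weight m b k * (gauss k (b + 1) * gauss (Suc k) (b + m))" for b k
  define stay where "stay b k = X ^ weight m b (Suc k) * (X ^ (b + m + 1) * gauss (Suc k) b * gauss k (b + m + 1))" for b k
  define left where "left b k = X ^ weight m b (Suc k) * (X ^ (b + m + 1) * gauss (Suc k) b *
    (gauss k (b + m + 2) - gauss k (b + m + 1)))" for b k
  \<comment> \<open>The inner difference is the box of width \<open>b - 1\<close>, and 0 for
    \<open>b = 0\<close>, where nothing arrives from a previous column.\<close>
  define up where "up b k = X ^ weight m b (Suc k) * (X ^ (m - 1) *
    (gauss (Suc (Suc k)) b - X ^ b * gauss (Suc k) b) * gauss k (b + m + 1))" for b k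
  have w: "b \<le> weight m b (Suc k)" "k \<le> weight m b (Suc k)" for b k
    using weight_ge[of b m "Suc k"] weight_ge(2)[of "Suc k" m b] by simp_all
  have gr: "graded t" "graded left" "graded up"
    unfolding t_def left_def up_def by (rule graded_X_power; use w weight_ge in auto)+
  have "dsum (\<lambda>b k. X ^ (weight m b (Suc k) + b + m + 1) * (gauss (Suc k) b * gauss k (b + m + 2))) n
      = dsum (\<lambda>b k. stay b k + left b k) n"
    by (rule dsum_cong) (simp add: stay_def left_def power_add algebra_simps del: gauss.simps)
  also have "\<dots> = dsum stay n + dsum (\<lambda>b k. left b (Suc k)) n"
  proof -
    have "dsum left n = dsum (\<lambda>b k. left b (Suc k)) n"
      by (rule dsum_shift_right_0[OF gr(2)]) (simp add: left_def)
    then show ?thesis unfolding dsum_add by simp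
  qed
  also have "dsum (\<lambda>b k. left b (Suc k)) n = dsum (\<lambda>b k. up (Suc b) k) n"
  proof (rule dsum_cong)
    fix b k
    have 1: "gauss (Suc k) (b + m + 2) - gauss (Suc k) (b + m + 1) = X ^ (b + m + 2) * gauss k (b + m + 2)"
      by simp
    have 2: "gauss (Suc (Suc k)) (Suc b) - X ^ Suc b * gauss (Suc k) (Suc b) = gauss (Suc (Suc k)) b"
      by simp
    have 3: "weight m b (Suc (Suc k)) + (b + m + 1) + (b + m + 2) = weight m (Suc b) (Suc k) + (m - 1)"
      using assms by (simp add: weight_def algebra_simps)
    have "left b (Suc k) = X ^ (weight m b (Suc (Suc k)) + (b + m + 1) + (b + m + 2)) *
        (gauss (Suc (Suc k)) b * gauss k (b + m + 2))"
      unfolding left_def 1 by (simp add: power_add mult_ac del: gauss.simps)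
    also have "\<dots> = up (Suc b) k"
      unfolding 3 up_def 2 by (simp add: power_add mult_ac del: gauss.simps)
    finally show "left b (Suc k) = up (Suc b) k" .
  qed
  also have "dsum (\<lambda>b k. up (Suc b) k) n = dsum up n"
    by (rule dsum_shift_left_0[OF gr(3), symmetric]) (simp add: up_def)
  finally have "dsum (\<lambda>b k. X ^ (weight m b (Suc k) + b + m + 1) * (gauss (Suc k) b * gauss k (b + m + 2))) n
      = dsum stay n + dsum up n" .
  moreover have "dsum (\<lambda>b k. t b (Suc k)) n \<le> dsum t n"
    by (rule dsum_shift_right_ge[OF gr(1)])
      (auto simp: t_def simp del: gauss.simps intro!: nonneg_fps_intros)
  moreover have "0 \<le> dsum (\<lambda>b k. t b (Suc k) - stay b k - up b k) n"
  proof (rule dsum_nonneg)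
    fix b k
    have "t b (Suc k) - stay b k - up b k = X ^ weight m b (Suc k) *
     (gauss (Suc k) (Suc b) * gauss (Suc (Suc k)) (b + m)
     - X ^ (b + m + 1) * gauss (Suc k) b * gauss k (b + m + 1)
     - X ^ (m - 1) * (gauss (Suc (Suc k)) b - X ^ b * gauss (Suc k) b) * gauss k (b + m + 1))"
      unfolding t_def stay_def up_def by (simp add: algebra_simps del: gauss.simps)
    then show "nonneg_fps (t b (Suc k) - stay b k - up b k)"
      using nonneg_site_pos[OF assms, of k b] by (auto simp del: gauss.simps intro!: nonneg_fps_mult nonneg_fps_power)
  qed
  ultimately show ?thesis
    unfolding dsum_diff unfolding t_def by linarith
qed

text \<open>
  For \<open>m = 0\<close> the shift of \<open>dsum_sites_pos\<close> would produce the factor \<open>X ^ (m - 1)\<close> with a negative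
  exponent. It is compensated by removing a part 1; partitions without parts 1 are split by Pascal's
  rule once more (\<open>st2\<close>, \<open>up2\<close>). In column \<open>b = 0\<close> there is no room for that, and the shift goes to
  row \<open>k - 2\<close> instead of \<open>k - 1\<close> (\<open>up0\<close>).
\<close>

lemma dsum_sites_0:
  "dsum (\<lambda>b k. X ^ (weight 0 b (Suc k) + b + 1) * (gauss (Suc k) b * gauss k (b + 2))) n
    \<le> dsum (\<lambda>b k. X ^ weight 0 b k * (gauss k (b + 1) * gauss (Suc k) b)) n"
proof -
  define w where "w b k = X ^ weight 0 b k" for b k
  define t where "t b k = w b k * (gauss k (b + 1) * gauss (Suc k) b)" for b k
  \<comment> \<open>From here on families are indexed by the position of the positive term that has
    to cover them. Row 0 must be kept, since \<open>up0\<close> reaches it at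
    \<open>b = 1\<close>.\<close>
  define st where "st b k = w b k * (case k of 0 \<Rightarrow> 0 | Suc k' \<Rightarrow> X ^ (b + 1) * gauss k b * gauss k' (b + 1))" for b k
  define left where "left b k = w b (Suc k) * (X ^ (b + 1) * gauss (Suc k) b * (gauss k (b + 2) - gauss k (b + 1)))" for b k
  define up0 where "up0 b k = w b k * (if b = 1 then X * gauss k 2 else 0)" for b k
  define up1 where "up1 b k = w b k * (case (b, k) of (Suc (Suc b'), Suc k') \<Rightarrow> gauss k (Suc b') * gauss k' (b + 1) | _ \<Rightarrow> 0)" for b k
  \<comment> \<open>The exponent \<open>2 * b + 3\<close> collects \<open>b + 1\<close> from the
    negative term and \<open>b + 2\<close> from Pascal's rule. Moving to column \<open>b + 1\<close>
    needs exactly one more factor \<open>X\<close>. Splitting \<open>gauss (Suc (Suc k)) b\<close>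
    by whether a part 1 occurs supplies it for \<open>up1\<close>; the portion without ones stays
    here.\<close>
  define l2 where "l2 b k = w b (Suc (Suc k)) * (if b = 0 then 0 else X ^ (2 * b + 3) * no_ones (Suc (Suc k)) b * gauss k (b + 2))" for b k
  define st2 where "st2 b k = w b k * (case k of Suc (Suc k') \<Rightarrow> (if b = 0 then 0 else X ^ (2 * b + 3) * no_ones k b * gauss k' (b + 1)) | _ \<Rightarrow> 0)" for b k
  define l3 where "l3 b k = w b (Suc (Suc k)) * (if b = 0 then 0 else X ^ (2 * b + 3) * no_ones (Suc (Suc k)) b * (gauss k (b + 2) - gauss k (b + 1)))" for b k
  define up2 where "up2 b k = w b k * (case (b, k) of (Suc (Suc b'), Suc (Suc k')) \<Rightarrow> X ^ b * no_ones (Suc k) (Suc b') * gauss k' (b + 1) | _ \<Rightarrow> 0)" for b k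
  have wt: "b \<le> weight 0 b (Suc k)" "k \<le> weight 0 b (Suc k)" "b \<le> weight 0 b (Suc (Suc k))" "k \<le> weight 0 b (Suc (Suc k))" for b k
    by (simp_all add: weight_def)
  have gr: "graded t" "graded left" "graded st" "graded up0" "graded up1" "graded l2" "graded st2" "graded l3" "graded up2"
    unfolding t_def left_def st_def up0_def up1_def l2_def st2_def l3_def up2_def w_def
    by (rule graded_X_power; use wt weight_ge in auto)+
  have step1: "dsum (\<lambda>b k. X ^ (weight 0 b (Suc k) + b + 1) * (gauss (Suc k) b * gauss k (b + 2))) n
      = dsum st n + dsum (\<lambda>b k. left b (Suc k)) n"
  proof -
    have "dsum (\<lambda>b k. X ^ (weight 0 b (Suc k) + b + 1) * (gauss (Suc k) b * gauss k (b + 2))) n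
       = dsum (\<lambda>b k. st b (Suc k) + left b k) n"
      by (rule dsum_cong) (simp add: st_def left_def w_def power_add algebra_simps del: gauss.simps)
    moreover have "dsum left n = dsum (\<lambda>b k. left b (Suc k)) n"
      by (rule dsum_shift_right_0[OF gr(2)]) (simp add: left_def)
    moreover have "dsum st n = dsum (\<lambda>b k. st b (Suc k)) n"
      by (rule dsum_shift_right_0[OF gr(3)]) (simp add: st_def)
    ultimately show ?thesis unfolding dsum_add by simp
  qed
  have step2: "dsum (\<lambda>b k. left b (Suc k)) n = dsum up0 n + dsum up1 n + dsum l2 n"
  proof -
    have "dsum (\<lambda>b k. left b (Suc k)) n = dsum (\<lambda>b k. up0 (Suc b) k + up1 (Suc b) (Suc k) + l2 b k) n"
    proof (rule dsum_cong)
      fix b k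
      have 1: "gauss (Suc k) (b + 2) - gauss (Suc k) (b + 1) = X ^ (b + 2) * gauss k (b + 2)" by simp
      have left: "left b (Suc k) = w b (Suc (Suc k)) * X ^ (2 * b + 3) * (gauss (Suc (Suc k)) b * gauss k (b + 2))"
        unfolding left_def 1 by (simp add: power_add mult_2 eval_nat_numeral mult_ac del: gauss.simps)
      show "left b (Suc k) = up0 (Suc b) k + up1 (Suc b) (Suc k) + l2 b k"
      proof (cases b)
        case 0
        have "weight 0 0 (Suc (Suc k)) + 3 = weight 0 1 k + 1" by (simp add: weight_def)
        then have "w 0 (Suc (Suc k)) * X ^ 3 = w 1 k * X"
          unfolding w_def by (metis power_add power_one_right)
        then show ?thesis unfolding left using 0
          by (simp add: up0_def up1_def l2_def eval_nat_numeral del: gauss.simps(2,3))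
      next
        case (Suc b')
        have "weight 0 b (Suc (Suc k)) + (2 * b + 3) + 1 = weight 0 (Suc b) (Suc k)"
          by (simp add: weight_def algebra_simps)
        then have 2: "w b (Suc (Suc k)) * X ^ (2 * b + 3) * X = w (Suc b) (Suc k)"
          unfolding w_def by (metis power_add power_one_right)
        have "left b (Suc k) = (w b (Suc (Suc k)) * X ^ (2 * b + 3) * X) * (gauss (Suc k) b * gauss k (b + 2)) + l2 b k"
          unfolding left using Suc by (simp add: l2_def algebra_simps del: gauss.simps)
        then show ?thesis
          unfolding 2 using Suc by (simp add: up0_def up1_def del: gauss.simps)
      qed
    qed
    also have "dsum (\<lambda>b k. up1 (Suc b) (Suc k)) n = dsum up1 n"
    proof -
      have "dsum up1 n = dsum (\<lambda>b k. up1 (Suc b) k) n"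
        by (rule dsum_shift_left_0[OF gr(5)]) (simp add: up1_def)
      also have "\<dots> = dsum (\<lambda>b k. up1 (Suc b) (Suc k)) n"
        by (rule dsum_shift_right_0[OF graded_shift_left[OF gr(5)]]) (simp add: up1_def split: nat.split)
      finally show ?thesis by simp
    qed
    moreover have "dsum (\<lambda>b k. up0 (Suc b) k) n = dsum up0 n"
      by (rule dsum_shift_left_0[OF gr(4), symmetric]) (simp add: up0_def)
    ultimately show ?thesis by (simp add: dsum_add)
  qed
  have step3: "dsum l2 n = dsum st2 n + dsum up2 n"
  proof -
    have "dsum l2 n = dsum (\<lambda>b k. st2 b (Suc (Suc k)) + l3 b k) n"
      by (rule dsum_cong) (simp add: l2_def st2_def l3_def algebra_simps del: gauss.simps)
    also have "\<dots> = dsum (\<lambda>b k. st2 b (Suc (Suc k))) n + dsum l3 n" by (rule dsum_add)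
    also have "dsum (\<lambda>b k. st2 b (Suc (Suc k))) n = dsum st2 n"
    proof -
      have "dsum st2 n = dsum (\<lambda>b k. st2 b (Suc k)) n"
        by (rule dsum_shift_right_0[OF gr(7)]) (simp add: st2_def)
      also have "\<dots> = dsum (\<lambda>b k. st2 b (Suc (Suc k))) n"
        by (rule dsum_shift_right_0[OF graded_shift_right[OF gr(7)]]) (simp add: st2_def)
      finally show ?thesis by simp
    qed
    also have "dsum l3 n = dsum (\<lambda>b k. l3 b (Suc k)) n"
      by (rule dsum_shift_right_0[OF gr(8)]) (simp add: l3_def)
    also have "\<dots> = dsum (\<lambda>b k. up2 (Suc b) (Suc (Suc k))) n"
    proof (rule dsum_cong)
      fix b k
      have 1: "gauss (Suc k) (b + 2) - gauss (Suc k) (b + 1) = X ^ (b + 2) * gauss k (b + 2)" by simp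
      show "l3 b (Suc k) = up2 (Suc b) (Suc (Suc k))"
      proof (cases b)
        case 0
        then show ?thesis by (simp add: l3_def up2_def)
      next
        case (Suc b')
        have "weight 0 b (Suc (Suc (Suc k))) + (2 * b + 3) + (b + 2) = weight 0 (Suc b) (Suc (Suc k)) + Suc b"
          by (simp add: weight_def algebra_simps)
        then have 2: "w b (Suc (Suc (Suc k))) * X ^ (2 * b + 3) * X ^ (b + 2) = w (Suc b) (Suc (Suc k)) * X ^ Suc b"
          unfolding w_def by (metis power_add)
        have "l3 b (Suc k) = (w b (Suc (Suc (Suc k))) * X ^ (2 * b + 3) * X ^ (b + 2)) *
           (no_ones (Suc (Suc (Suc k))) b * gauss k (b + 2))"
          unfolding l3_def 1 using Suc by (simp add: mult_ac del: gauss.simps no_ones.simps)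
        then show ?thesis
          unfolding 2 up2_def using Suc by (simp add: mult_ac del: gauss.simps no_ones.simps)
      qed
    qed
    also have "\<dots> = dsum up2 n"
    proof -
      have "dsum up2 n = dsum (\<lambda>b k. up2 (Suc b) k) n"
        by (rule dsum_shift_left_0[OF gr(9)]) (simp add: up2_def)
      also have "\<dots> = dsum (\<lambda>b k. up2 (Suc b) (Suc k)) n"
        by (rule dsum_shift_right_0[OF graded_shift_left[OF gr(9)]]) (simp add: up2_def split: nat.split)
      also have "\<dots> = dsum (\<lambda>b k. up2 (Suc b) (Suc (Suc k))) n"
        by (rule dsum_shift_right_0[OF graded_shift_right[OF graded_shift_left[OF gr(9)]]])
          (simp add: up2_def split: nat.split)
      finally show ?thesis by simp
    qed
    finally show ?thesis .
  qed
  have "0 \<le> dsum (\<lambda>b k. t b k - st b k - up0 b k - up1 b k - up2 b k - st2 b k) n"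
  proof (rule dsum_nonneg)
    fix b k
    define th where "th = gauss k (b + 1) * gauss (Suc k) b
      - (case k of 0 \<Rightarrow> 0 | Suc k' \<Rightarrow> X ^ (b + 1) * gauss k b * gauss k' (b + 1))
      - (if b = 1 then X * gauss k 2 else 0)
      - (case (b, k) of (Suc (Suc b'), Suc k') \<Rightarrow> gauss k (Suc b') * gauss k' (b + 1) | _ \<Rightarrow> 0)
      - (case (b, k) of (Suc (Suc b'), Suc (Suc k')) \<Rightarrow> X ^ b * no_ones (Suc k) (Suc b') * gauss k' (b + 1) | _ \<Rightarrow> 0)
      - (case k of Suc (Suc k') \<Rightarrow> (if b = 0 then 0 else X ^ (2 * b + 3) * no_ones k b * gauss k' (b + 1)) | _ \<Rightarrow> 0)"
    have "nonneg_fps th"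
    proof -
      consider "b = 0" "k = 0" | "b = 1" "k = 0" | "b \<ge> 2" "k = 0"
        | k' where "b = 0" "k = Suc k'" | "b = 1" "k = 1" | k' where "b = 1" "k = Suc (Suc k')"
        | b' where "b = Suc (Suc b')" "k = 1" | b' k' where "b = Suc (Suc b')" "k = Suc (Suc k')"
      proof (cases b)
        case 0
        then show ?thesis using that(1,4) by (cases k) auto
      next
        case (Suc b1)
        show ?thesis
        proof (cases b1)
          case 0
          show ?thesis
          proof (cases k)
            case (Suc k1)
            then show ?thesis using that(5,6) \<open>b = Suc b1\<close> 0 by (cases k1) auto
          qed (use that(2) \<open>b = Suc b1\<close> 0 in auto)
        next
          case (Suc b2)
          show ?thesis
          proof (cases k)
            case (Suc k1)
            then show ?thesis using that(7,8) \<open>b = Suc b1\<close> \<open>b1 = Suc b2\<close> by (cases k1) auto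
          qed (use that(3) \<open>b = Suc b1\<close> Suc in auto)
        qed
      qed
      then show ?thesis
      proof cases
        case 1 then show ?thesis by (simp add: th_def)
      next
        case 2 then show ?thesis by (simp add: th_def)
      next
        case 3 then show ?thesis
          by (auto simp: th_def simp del: gauss.simps(2,3) split: nat.split intro!: nonneg_fps_intros)
      next
        case 4
        have "th = gauss (Suc k') 1 - X * gauss k' 1"
          using 4 by (simp add: th_def del: gauss.simps(2,3) split: nat.split)
        then show ?thesis using nonneg_gauss_add_part[of 1 1 k'] by simp
      next
        case 5
        have "th = 1 + X + X^2 + X^4"
          using 5 by (simp add: th_def eval_nat_numeral algebra_simps)
        then show ?thesis by (simp only:) (intro nonneg_fps_intros nonneg_fps_X nonneg_fps_1)
      next
        case 6
        have "no_ones (Suc (Suc k')) 1 = 1" by simp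
        then have "th = gauss (Suc (Suc k')) 2 * gauss (Suc (Suc (Suc k'))) 1
     - X^2 * gauss (Suc (Suc k')) 1 * gauss (Suc k') 2 - X * gauss (Suc (Suc k')) 2 - X^5 * gauss k' 2"
          using 6 by (simp add: th_def eval_nat_numeral del: gauss.simps no_ones.simps)
        then show ?thesis using nonneg_site_0_col_1[of k'] by simp
      next
        case 7
        have "th = gauss 1 (Suc b' + 2) * gauss 2 (Suc b' + 1) - X ^ (Suc b' + 2) * gauss 1 (Suc b' + 1) - gauss 1 (Suc b')"
          using 7 by (simp add: th_def eval_nat_numeral del: gauss.simps(2,3))
        then show ?thesis using nonneg_site_0_row_1[of "Suc b'"] by (simp only:)
      next
        case 8
        have "th = gauss (Suc (Suc k')) (Suc b) * gauss (Suc (Suc (Suc k'))) b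
     - X ^ Suc b * gauss (Suc (Suc k')) b * gauss (Suc k') (Suc b)
     - gauss (Suc (Suc k')) (Suc b') * gauss (Suc k') (Suc b)
     - X ^ b * no_ones (Suc (Suc (Suc k'))) (Suc b') * gauss k' (Suc b)
     - X ^ (2 * b + 3) * no_ones (Suc (Suc k')) b * gauss k' (Suc b)"
          using 8 by (simp add: th_def del: gauss.simps no_ones.simps)
        then show ?thesis using nonneg_site_0[of k' b', folded 8(1)] by (simp only:)
      qed
    qed
    moreover have "t b k - st b k - up0 b k - up1 b k - up2 b k - st2 b k = w b k * th"
      unfolding t_def st_def up0_def up1_def st2_def up2_def th_def
      by (simp only: right_diff_distrib)
    ultimately show "nonneg_fps (t b k - st b k - up0 b k - up1 b k - up2 b k - st2 b k)"
      unfolding w_def by (simp only:) (intro nonneg_fps_intros nonneg_fps_X)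
  qed
  then show ?thesis
    unfolding step1 step2 step3 unfolding dsum_diff unfolding t_def w_def by linarith
qed

lemma dsum_symbols:
  "dsum (\<lambda>a i. X ^ ((a + 1) * (a + 1 + m) + a + 1 + i) * (gauss i a * gauss i (a + m + 1))) n
   \<le> dsum (\<lambda>a i. X ^ ((a + 1) * (a + 1 + m) + i) * (gauss i a * gauss i (a + m))) n"
proof (cases "m = 0")
  case True
  then show ?thesis
    using dsum_reduction[of 0 n] dsum_sites_0[of n] by simp
next
  case False
  then show ?thesis
    using dsum_reduction[of m n] dsum_sites_pos[of m n] by simp
qed

section \<open>Durfee rectangles\<close>

definition box :: "nat \<Rightarrow> nat \<Rightarrow> nat list set" where
  "box k b = {xs. length xs = k \<and> sorted_wrt (\<ge>) xs \<and> set xs \<subseteq> {..b}}"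

lemma finite_box: "finite (box k b)"
  using finite_lists_length_eq[of "{..b}" k] by (rule rev_finite_subset) (auto simp: box_def)

lemma box_Suc_Suc: "box (Suc k) (Suc b) = box (Suc k) b \<union> (#) (Suc b) ` box k (Suc b)"
proof (intro equalityI subsetI)
  fix xs assume xs: "xs \<in> box (Suc k) (Suc b)"
  then obtain y ys where [simp]: "xs = y # ys" by (cases xs) (auto simp: box_def)
  show "xs \<in> box (Suc k) b \<union> (#) (Suc b) ` box k (Suc b)"
  proof (cases "y = Suc b")
    case False
    then have "y \<le> b" using xs by (auto simp: box_def)
    then have "xs \<in> box (Suc k) b" using xs by (auto simp: box_def)
    then show ?thesis ..
  qed (use xs in \<open>auto simp: box_def\<close>)
qed (auto simp: box_def)

text \<open>Padding with zeros makes all partitions in the box lists of the same length, so that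
  splitting off a first entry \<open>Suc b\<close> is precisely the recursion of
  \<open>gauss\<close>.\<close>

lemma card_box: "int (card {xs \<in> box k b. sum_list xs = n}) = fps_nth (gauss k b) n"
proof (induction k b arbitrary: n rule: gauss.induct)
  case (1 b)
  have "{xs \<in> box 0 b. sum_list xs = n} = (if n = 0 then {[]} else {})"
    by (auto simp: box_def)
  then show ?case by simp
next
  case (2 a)
  obtain r where r: "r = replicate (Suc a) (0 :: nat)" by blast
  have "sorted_wrt (\<ge>) r" unfolding r by (induction a) auto
  then have "r \<in> box (Suc a) 0" by (auto simp: box_def r)
  moreover have "xs = r" if "xs \<in> box (Suc a) 0" for xs
    using that unfolding box_def r by (intro replicate_eqI) auto
  ultimately have box: "box (Suc a) 0 = {r}" by blast
  have 0: "sum_list r = 0" by (simp add: r sum_list_replicate)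
  have "sum_list r = n \<longleftrightarrow> n = 0" unfolding 0 by auto
  then have "{xs \<in> box (Suc a) 0. sum_list xs = n} = (if n = 0 then {r} else {})"
    unfolding box by auto
  then show ?case by simp
next
  case (3 a b)
  have "{xs \<in> box (Suc a) (Suc b). sum_list xs = n} = {xs \<in> box (Suc a) b. sum_list xs = n} \<union>
     (#) (Suc b) ` {xs \<in> box a (Suc b). Suc b + sum_list xs = n}"
    unfolding box_Suc_Suc by auto
  moreover have "card \<dots> = card {xs \<in> box (Suc a) b. sum_list xs = n} +
     card ((#) (Suc b) ` {xs \<in> box a (Suc b). Suc b + sum_list xs = n})"
  proof (rule card_Un_disjoint)
    show "finite {xs \<in> box (Suc a) b. sum_list xs = n}"
      using finite_box by simp
    show "finite ((#) (Suc b) ` {xs \<in> box a (Suc b). Suc b + sum_list xs = n})"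
      using finite_box by simp
    have "Suc b \<notin> set xs" if "xs \<in> box (Suc a) b" for xs
      using that by (auto simp: box_def)
    then show "{xs \<in> box (Suc a) b. sum_list xs = n} \<inter>
        (#) (Suc b) ` {xs \<in> box a (Suc b). Suc b + sum_list xs = n} = {}"
      by fastforce
  qed
  moreover have "card ((#) (Suc b) ` {xs \<in> box a (Suc b). Suc b + sum_list xs = n}) =
     card {xs \<in> box a (Suc b). Suc b + sum_list xs = n}"
    by (rule card_image) simp
  moreover have "{xs \<in> box a (Suc b). Suc b + sum_list xs = n} =
     (if n < Suc b then {} else {xs \<in> box a (Suc b). sum_list xs = n - Suc b})"
    by auto
  ultimately show ?case
    using 3 by (simp add: fps_X_power_mult_nth del: power_Suc)
qed

lemma card_box_pairs:
  "int (card {(x, y). x \<in> box k b \<and> y \<in> box l c \<and> e + sum_list x + sum_list y = n})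
    = fps_nth (X ^ e * (gauss k b * gauss l c)) n"
proof (cases "n < e")
  case True
  then have "{(x, y). x \<in> box k b \<and> y \<in> box l c \<and> e + sum_list x + sum_list y = n} = {}"
    by auto
  then show ?thesis using True by (simp add: fps_X_power_mult_nth)
next
  case False
  have "{(x, y). x \<in> box k b \<and> y \<in> box l c \<and> e + sum_list x + sum_list y = n} =
    (\<Union>i\<in>{0..n - e}. {x \<in> box k b. sum_list x = i} \<times> {y \<in> box l c. sum_list y = n - e - i})"
    using False by auto
  moreover have "card \<dots> = (\<Sum>i\<in>{0..n - e}. card ({x \<in> box k b. sum_list x = i} \<times> {y \<in> box l c. sum_list y = n - e - i}))"
    by (rule card_UN_disjoint) (auto simp: finite_box)
  moreover have "fps_nth (X ^ e * (gauss k b * gauss l c)) n = fps_nth (gauss k b * gauss l c) (n - e)"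
    using False by (simp only: fps_X_power_mult_nth if_False)
  ultimately show ?thesis
    by (simp add: fps_mult_nth card_cartesian_product card_box)
qed

lemma card_symbols:
  "int (card {(a, i, x, y). a \<le> n \<and> i \<le> n \<and> x \<in> box (k a i) (b a i) \<and> y \<in> box (l a i) (c a i) \<and>
     e a i + sum_list x + sum_list y = n})
   = dsum (\<lambda>a i. X ^ e a i * (gauss (k a i) (b a i) * gauss (l a i) (c a i))) n"
proof -
  let ?S = "\<lambda>a i. {(x, y). x \<in> box (k a i) (b a i) \<and> y \<in> box (l a i) (c a i) \<and> e a i + sum_list x + sum_list y = n}"
  have fin: "finite (?S a i)" for a i
    by (rule finite_subset[of _ "box (k a i) (b a i) \<times> box (l a i) (c a i)"]) (auto simp: finite_box)
  have "{(a, i, x, y). a \<le> n \<and> i \<le> n \<and> x \<in> box (k a i) (b a i) \<and> y \<in> box (l a i) (c a i) \<and>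
     e a i + sum_list x + sum_list y = n} = (SIGMA a:{..n}. SIGMA i:{..n}. ?S a i)"
    by auto
  moreover have "card \<dots> = (\<Sum>a\<le>n. \<Sum>i\<le>n. card (?S a i))"
    using fin by (simp add: card_SigmaI)
  ultimately show ?thesis
    by (simp add: dsum_def card_box_pairs)
qed

text \<open>\<open>ys\<close> is the part of \<open>ys @ zs\<close> containing the \<open>(m + j) \<times> j\<close> Durfee rectangle.\<close>

definition durfee :: "nat \<Rightarrow> nat \<Rightarrow> nat list \<Rightarrow> nat list \<Rightarrow> bool" where
  "durfee m j ys zs \<longleftrightarrow> 1 \<le> j \<and> length ys = j + m \<and> sorted_wrt (\<ge>) ys \<and> sorted_wrt (\<ge>) zs \<and>
     (\<forall>y\<in>set ys. j \<le> y) \<and> (\<forall>z\<in>set zs. 0 < z \<and> z \<le> j)"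

section \<open>Existence and uniqueness of the Durfee rectangle, and how it detects rank and
  rank-set\<close>

lemma durfee_unique:
  assumes "durfee m j ys zs" "durfee m j' ys' zs'" "ys @ zs = ys' @ zs'"
  shows "j = j' \<and> ys = ys' \<and> zs = zs'"
proof -
  \<comment> \<open>If \<open>j < j'\<close>, the entry at index \<open>j + m\<close> lies below the
    first rectangle, hence is at most \<open>j\<close>, but beside the second one, hence is at least
    \<open>j'\<close>.\<close>
  have *: "\<not> j < j'" if d: "durfee m j ys zs" "durfee m j' ys' zs'" "ys @ zs = ys' @ zs'"
    for j j' ys ys' zs zs'
  proof
    assume "j < j'"
    let ?i = "j + m"
    have len: "?i < length ys'" "?i = length ys" using d \<open>j < j'\<close> by (auto simp: durfee_def)
    have "length ys + length zs = length ys' + length zs'"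
      using d(3) by (metis length_append)
    then have "zs \<noteq> []" using len by auto
    then have 1: "(ys @ zs) ! ?i = zs ! 0" "zs ! 0 \<in> set zs" using len by (auto simp: nth_append)
    have 2: "(ys' @ zs') ! ?i = ys' ! ?i" "ys' ! ?i \<in> set ys'" using len by (auto simp: nth_append)
    have "zs ! 0 \<le> j" "j' \<le> ys' ! ?i" using d(1,2) 1(2) 2(2) by (simp_all add: durfee_def)
    then show False using 1(1) 2(1) d(3) \<open>j < j'\<close> by simp
  qed
  have "j = j'" using *[OF assms] *[OF assms(2,1) assms(3)[symmetric]] by simp
  then show ?thesis using assms by (auto simp: durfee_def)
qed

text \<open>Take the largest \<open>j\<close> such that the first \<open>j + m\<close> parts are at
  least \<open>j\<close>. By sortedness, a part exceeding \<open>j\<close> after them would make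
  \<open>Suc j\<close> admissible as well.\<close>

lemma durfee_exists:
  assumes "sorted_wrt (\<ge>) xs" "\<forall>x\<in>set xs. 0 < x" "m < length xs"
  shows "\<exists>j ys zs. durfee m j ys zs \<and> xs = ys @ zs"
proof -
  define ok where "ok j \<longleftrightarrow> j + m \<le> length xs \<and> (\<forall>i < j + m. j \<le> xs ! i)" for j
  have "ok 1" using assms by (auto simp: ok_def Suc_le_eq)
  moreover have bound: "\<And>j. ok j \<Longrightarrow> j \<le> length xs" by (auto simp: ok_def)
  ultimately obtain j where j: "ok j" "\<And>j'. ok j' \<Longrightarrow> j' \<le> j"
    using GreatestI_nat[of ok 1 "length xs"] Greatest_le_nat[of ok _ "length xs"] by blast
  have "1 \<le> j" using j \<open>ok 1\<close> by blast
  have le: "z \<le> j" if z: "z \<in> set (drop (j + m) xs)" for z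
  proof (rule ccontr)
    assume "\<not> z \<le> j"
    obtain t where "t < length (drop (j + m) xs)" "drop (j + m) xs ! t = z"
      using z by (meson in_set_conv_nth)
    then have "j + m + t < length xs \<and> j + m \<le> j + m + t \<and> z = xs ! (j + m + t)"
      using j(1) by (auto simp: ok_def)
    then obtain i where i: "i < length xs" "j + m \<le> i" "z = xs ! i"
      by blast
    have "ok (Suc j)"
      unfolding ok_def
    proof (intro conjI allI impI)
      show "Suc j + m \<le> length xs" using i by simp
      fix i' assume "i' < Suc j + m"
      then have "i' \<le> i" using i by simp
      then have "xs ! i \<le> xs ! i'"
        using assms(1) i(1) by (cases "i' = i") (auto simp: sorted_wrt_iff_nth_less)
      then show "Suc j \<le> xs ! i'" using \<open>\<not> z \<le> j\<close> i by simp
    qed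
    then show False using j(2)[of "Suc j"] by simp
  qed
  have "durfee m j (take (j + m) xs) (drop (j + m) xs)"
    unfolding durfee_def
  proof (intro conjI ballI)
    show "length (take (j + m) xs) = j + m" using j(1) by (simp add: ok_def)
    show "j \<le> y" if y: "y \<in> set (take (j + m) xs)" for y
    proof -
      obtain t where "t < length (take (j + m) xs)" "take (j + m) xs ! t = y"
        using y by (meson in_set_conv_nth)
      then show ?thesis using j(1) by (auto simp: ok_def)
    qed
    show "0 < z" if "z \<in> set (drop (j + m) xs)" for z
      using assms(2) in_set_dropD[OF that] by blast
  qed (use \<open>1 \<le> j\<close> le assms(1) in \<open>simp_all add: sorted_wrt_take sorted_wrt_drop\<close>)
  then show ?thesis by (metis append_take_drop_id)
qed

lemma durfee_partition:
  assumes "durfee m j ys zs"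
  shows "ys @ zs \<in> partitions n \<longleftrightarrow> sum_list ys + sum_list zs = n"
proof -
  have "sorted_wrt (\<ge>) (ys @ zs)" and "\<forall>x\<in>set (ys @ zs). 0 < x"
    using assms unfolding durfee_def sorted_wrt_append by (auto intro: le_trans)
  then show ?thesis by (simp add: partitions_def)
qed

text \<open>The value \<open>m\<close> occurs at index \<open>i\<close> iff the part there equals
  \<open>i - m\<close>. Before index \<open>j + m\<close> the parts are at least
  \<open>j > i - m\<close>; from there on they are at most \<open>j <= i - m\<close>, with equality
  only for \<open>i = j + m\<close> and part \<open>j\<close>. The tail of the rank-set starts
  beyond \<open>m\<close>.\<close>

lemma durfee_rank_set:
  assumes "durfee m j ys zs"
  shows "int m \<in> rank_set (ys @ zs) \<longleftrightarrow> zs \<noteq> [] \<and> hd zs = j"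
proof
  assume "int m \<in> rank_set (ys @ zs)"
  moreover have "m < length (ys @ zs)" using assms by (auto simp: durfee_def)
  ultimately obtain i where i: "i < length (ys @ zs)" "int m = int i - int ((ys @ zs) ! i)"
    by (auto simp: rank_set_def)
  have i': "\<not> i < j + m"
  proof
    assume "i < j + m"
    then have "j \<le> (ys @ zs) ! i" using assms by (auto simp: durfee_def nth_append)
    then show False using i(2) \<open>i < j + m\<close> by simp
  qed
  then have nth: "(ys @ zs) ! i = zs ! (i - (j + m))" and *: "i - (j + m) < length zs"
    using assms i(1) by (auto simp: durfee_def nth_append)
  then have "zs ! (i - (j + m)) \<le> j" using assms by (auto simp: durfee_def)
  with i(2) nth i' have "i = j + m" "zs ! (i - (j + m)) = j" by linarith+
  then show "zs \<noteq> [] \<and> hd zs = j" using * by (auto simp: hd_conv_nth)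
next
  assume "zs \<noteq> [] \<and> hd zs = j"
  then have "j + m < length (ys @ zs)" "(ys @ zs) ! (j + m) = j"
    using assms by (auto simp: durfee_def nth_append hd_conv_nth)
  then show "int m \<in> rank_set (ys @ zs)"
    unfolding rank_set_def by (intro UnI1 CollectI exI[of _ "j + m"]) auto
qed

lemma durfee_prank:
  assumes "durfee m j ys zs"
  shows "- int m \<le> prank (ys @ zs) \<longleftrightarrow> length zs + j \<le> hd ys"
proof -
  have "ys \<noteq> []" using assms by (auto simp: durfee_def)
  then show ?thesis using assms by (auto simp: durfee_def prank_def)
qed

section \<open>Bounding the two set differences by double sums\<close>

lemma finite_partitions: "finite (partitions n)"
proof (rule finite_subset)
  show "partitions n \<subseteq> {xs. set xs \<subseteq> {..n} \<and> length xs \<le> n}"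
  proof
    fix xs assume "xs \<in> partitions n"
    then have *: "\<forall>x\<in>set xs. 0 < x" "sum_list xs = n" by (auto simp: partitions_def)
    have "length xs \<le> sum_list xs" using *(1) by (induction xs) auto
    moreover have "x \<le> sum_list xs" if "x \<in> set xs" for x using that member_le_sum_list[of x xs] by simp
    ultimately show "xs \<in> {xs. set xs \<subseteq> {..n} \<and> length xs \<le> n}" using *(2) by auto
  qed
  show "finite {xs. set xs \<subseteq> {..n} \<and> length xs \<le> n}"
    by (rule finite_lists_length_le) simp
qed

lemma sum_list_map_add: "sum_list (map (\<lambda>t. t + c) xs) = sum_list xs + length xs * (c :: nat)"
  by (induction xs) auto

lemma sum_list_filter_pos: "sum_list (filter (\<lambda>t. 0 < t) xs) = sum_list (xs :: nat list)"
  by (induction xs) auto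

lemma sorted_filter_pos_pad:
  "sorted_wrt (\<ge>) (ys :: nat list) \<Longrightarrow>
    ys = filter (\<lambda>t. 0 < t) ys @ replicate (length ys - length (filter (\<lambda>t. 0 < t) ys)) 0"
proof (induction ys)
  case (Cons y ys)
  show ?case
  proof (cases "y = 0")
    case True
    then have 0: "\<forall>t\<in>set (y # ys). t = 0" using Cons.prems by auto
    then have "filter (\<lambda>t. 0 < t) (y # ys) = []" by (simp add: filter_empty_conv)
    moreover have "y # ys = replicate (length (y # ys)) 0" using 0 by (intro replicate_eqI) auto
    ultimately show ?thesis by simp
  qed (use Cons in simp)
qed simp

text \<open>With \<open>j = a + 1\<close>, let \<open>i\<close> be the largest part of the partition
  to the right of the rectangle. The rank condition allows at most \<open>i\<close> parts below the
  rectangle, and missing the rank-set means that these are at most \<open>a\<close>. Both pieces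
  thus range over boxes.\<close>

lemma card_rank_only_ge:
  "dsum (\<lambda>a i. X ^ ((a + 1) * (a + 1 + m) + i) * (gauss i a * gauss i (a + m))) n
    \<le> int (card {xs \<in> partitions n. - int m \<le> prank xs \<and> int m \<notin> rank_set xs})"
proof -
  define S where "S = {(a, i, x, y). a \<le> n \<and> i \<le> n \<and> x \<in> box (a + m) i \<and> y \<in> box i a \<and>
    ((a + 1) * (a + 1 + m) + i) + sum_list x + sum_list y = n}"
  \<comment> \<open>Placing \<open>i\<close> in front makes it the exact largest part to the right
    of the rectangle, so that \<open>i\<close> can be read off from the partition.\<close>
  define top where "top a i x = map (\<lambda>t. t + (a + 1)) (i # x)" for a i :: nat and x
  define f where "f = (\<lambda>(a, i, x, y). top a i x @ filter (\<lambda>t. 0 < t) y)"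
  have durfee: "durfee m (a + 1) (top a i x) (filter (\<lambda>t. 0 < t) y)"
    if "x \<in> box (a + m) i" "y \<in> box i a" for a i x y
  proof -
    have "sorted_wrt (\<ge>) (i # x)" using that(1) by (auto simp: box_def)
    then have "sorted_wrt (\<ge>) (top a i x)" by (simp add: top_def sorted_wrt_map)
    then show ?thesis using that
      by (auto simp: durfee_def top_def box_def intro: sorted_wrt_filter)
  qed
  have "f ` S \<subseteq> {xs \<in> partitions n. - int m \<le> prank xs \<and> int m \<notin> rank_set xs}"
  proof (rule image_subsetI)
    fix s assume "s \<in> S"
    then obtain a i x y where s: "s = (a, i, x, y)" and xy: "x \<in> box (a + m) i" "y \<in> box i a"
      and sum: "((a + 1) * (a + 1 + m) + i) + sum_list x + sum_list y = n"
      by (auto simp: S_def)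
    note d = durfee[OF xy]
    have "length x = a + m" "length y = i" "set y \<subseteq> {..a}" using xy by (auto simp: box_def)
    have "sum_list (top a i x) = (a + 1) * (a + 1 + m) + i + sum_list x"
      unfolding top_def sum_list_map_add using \<open>length x = a + m\<close> by (simp add: algebra_simps)
    then have "top a i x @ filter (\<lambda>t. 0 < t) y \<in> partitions n"
      unfolding durfee_partition[OF d] sum_list_filter_pos using sum by simp
    moreover have "length (filter (\<lambda>t. 0 < t) y) + (a + 1) \<le> hd (top a i x)"
      using length_filter_le[of "\<lambda>t. 0 < t" y] \<open>length y = i\<close> by (simp add: top_def)
    moreover have "\<not> (filter (\<lambda>t. 0 < t) y \<noteq> [] \<and> hd (filter (\<lambda>t. 0 < t) y) = a + 1)"
    proof
      assume *: "filter (\<lambda>t. 0 < t) y \<noteq> [] \<and> hd (filter (\<lambda>t. 0 < t) y) = a + 1"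
      then have "hd (filter (\<lambda>t. 0 < t) y) \<in> set (filter (\<lambda>t. 0 < t) y)" by (intro hd_in_set) simp
      then have "a + 1 \<in> set y" using * by simp
      then show False using \<open>set y \<subseteq> {..a}\<close> by auto
    qed
    ultimately show "f s \<in> {xs \<in> partitions n. - int m \<le> prank xs \<and> int m \<notin> rank_set xs}"
      unfolding s f_def using durfee_prank[OF d] durfee_rank_set[OF d] by simp
  qed
  moreover have "inj_on f S"
  proof (rule inj_onI)
    fix s s' assume "s \<in> S" "s' \<in> S" and eq: "f s = f s'"
    from \<open>s \<in> S\<close> obtain a i x y where s: "s = (a, i, x, y)" and xy: "x \<in> box (a + m) i" "y \<in> box i a"
      by (auto simp: S_def)
    from \<open>s' \<in> S\<close> obtain a' i' x' y' where s': "s' = (a', i', x', y')"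
      and xy': "x' \<in> box (a' + m) i'" "y' \<in> box i' a'"
      by (auto simp: S_def)
    have *: "a + 1 = a' + 1 \<and> top a i x = top a' i' x' \<and> filter (\<lambda>t. 0 < t) y = filter (\<lambda>t. 0 < t) y'"
      using eq unfolding s s' f_def by (intro durfee_unique[OF durfee[OF xy] durfee[OF xy']]) simp
    then have "a = a'" by simp
    then have "i # x = i' # x'"
      using * unfolding top_def by (metis (no_types, lifting) add_right_imp_eq inj_onI map_inj_on)
    \<comment> \<open>The zeros removed by \<open>filter\<close> are recovered because both lists
      now have the same length \<open>i\<close>.\<close>
    moreover have "y = y'"
      using sorted_filter_pos_pad[of y] sorted_filter_pos_pad[of y'] xy xy' * calculation
      unfolding box_def by (metis (mono_tags, lifting) list.inject mem_Collect_eq)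
    ultimately show "s = s'" using \<open>a = a'\<close> s s' by simp
  qed
  ultimately have "card S \<le> card {xs \<in> partitions n. - int m \<le> prank xs \<and> int m \<notin> rank_set xs}"
    using finite_partitions by (intro card_inj_on_le[of f]) auto
  moreover have "int (card S) = dsum (\<lambda>a i. X ^ ((a + 1) * (a + 1 + m) + i) * (gauss (a + m) i * gauss i a)) n"
    unfolding S_def by (rule card_symbols)
  moreover have "\<dots> = dsum (\<lambda>a i. X ^ ((a + 1) * (a + 1 + m) + i) * (gauss i a * gauss i (a + m))) n"
    by (rule dsum_cong) (metis gauss_commute mult.commute)
  ultimately show ?thesis by simp
qed

text \<open>Below the rectangle the first part is \<open>j = a + 1\<close>; this is the extra
  \<open>a + 1\<close> in the exponent. Let \<open>i\<close> be the number of parts after it.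
  Lowering each of them by 1 gives the exponent \<open>i\<close> and entries up to \<open>a\<close>,
  while the violated rank condition bounds the parts to the right of the rectangle by
  \<open>i\<close>.\<close>

lemma card_rank_set_only_le:
  "int (card {xs \<in> partitions n. int m \<in> rank_set xs \<and> \<not> - int m \<le> prank xs})
    \<le> dsum (\<lambda>a i. X ^ ((a + 1) * (a + 1 + m) + a + 1 + i) * (gauss i a * gauss i (a + m + 1))) n"
proof -
  define S where "S = {(a, i, x, y). a \<le> n \<and> i \<le> n \<and> x \<in> box (a + m + 1) i \<and> y \<in> box i a \<and>
    ((a + 1) * (a + 1 + m) + a + 1 + i) + sum_list x + sum_list y = n}"
  define f where "f = (\<lambda>(a :: nat, i :: nat, x, y). map (\<lambda>t. t + (a + 1)) x @ (a + 1) # map (\<lambda>t. t + 1) y)"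
  have "{xs \<in> partitions n. int m \<in> rank_set xs \<and> \<not> - int m \<le> prank xs} \<subseteq> f ` S"
  proof
    fix xs assume xs: "xs \<in> {xs \<in> partitions n. int m \<in> rank_set xs \<and> \<not> - int m \<le> prank xs}"
    \<comment> \<open>A rank below \<open>- m\<close> means that the length exceeds
      \<open>m + hd xs\<close>, so there is room for a rectangle with \<open>j >= 1\<close>.\<close>
    then have "m < length xs" by (auto simp: prank_def)
    then obtain j ys zs where d: "durfee m j ys zs" and xs_eq: "xs = ys @ zs"
      using durfee_exists[of xs m] xs by (auto simp: partitions_def)
    have sum: "sum_list ys + sum_list zs = n" using xs durfee_partition[OF d] xs_eq by simp
    have zs: "zs \<noteq> []" "hd zs = j" using xs durfee_rank_set[OF d] xs_eq by simp_all
    have rank: "hd ys < length zs + j" using xs durfee_prank[OF d] xs_eq by simp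
    obtain a where j: "j = a + 1" using d by (cases j) (auto simp: durfee_def)
    obtain zs' where zs': "zs = j # zs'" using zs by (cases zs) auto
    define x where "x = map (\<lambda>t. t - j) ys"
    define y where "y = map (\<lambda>t. t - 1) zs'"
    have ys: "map (\<lambda>t. t + j) x = ys"
      using d unfolding x_def durfee_def by (auto simp: map_idI)
    have zs'': "map (\<lambda>t. t + 1) y = zs'"
      using d unfolding y_def durfee_def zs' by (auto simp: map_idI)
    have "sorted_wrt (\<ge>) x" "sorted_wrt (\<ge>) y"
      using d unfolding x_def y_def durfee_def zs' sorted_wrt_map
      by (auto elim!: sorted_wrt_mono_rel[rotated])
    moreover have "t \<le> hd ys" if "t \<in> set ys" for t
      using d that by (cases ys) (auto simp: durfee_def)
    then have "set x \<subseteq> {..length zs'}"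
      using rank unfolding x_def zs' by fastforce
    moreover have "set y \<subseteq> {..a}"
      using d unfolding y_def zs' durfee_def j by fastforce
    moreover have len: "length x = a + m + 1" "length y = length zs'"
      using d by (simp_all add: x_def y_def durfee_def j)
    ultimately have "x \<in> box (a + m + 1) (length zs')" "y \<in> box (length zs') a"
      by (simp_all add: box_def)
    moreover have s: "((a + 1) * (a + 1 + m) + a + 1 + length zs') + sum_list x + sum_list y = n"
    proof -
      have "sum_list ys = sum_list x + (a + m + 1) * (a + 1)"
        unfolding ys[symmetric] sum_list_map_add len j by simp
      moreover have "sum_list zs = (a + 1) + sum_list y + length zs'"
        using sum_list_map_add[of 1 y] zs'' len zs' j by simp
      ultimately show ?thesis using sum by (simp add: algebra_simps)
    qed
    moreover have "a \<le> n" "length zs' \<le> n" using s by auto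
    ultimately have "(a, length zs', x, y) \<in> S" unfolding S_def by simp
    moreover have "f (a, length zs', x, y) = xs"
      unfolding f_def xs_eq zs' using ys zs'' j by simp
    ultimately show "xs \<in> f ` S" by (metis image_eqI)
  qed
  moreover have "finite S"
  proof (rule finite_subset)
    show "S \<subseteq> (SIGMA a:{..n}. SIGMA i:{..n}. box (a + m + 1) i \<times> box i a)"
      by (auto simp: S_def)
  qed (auto simp: finite_box)
  ultimately have "card {xs \<in> partitions n. int m \<in> rank_set xs \<and> \<not> - int m \<le> prank xs} \<le> card S"
    by (rule surj_card_le[rotated])
  moreover have "int (card S) = dsum (\<lambda>a i. X ^ ((a + 1) * (a + 1 + m) + a + 1 + i) * (gauss (a + m + 1) i * gauss i a)) n"
    unfolding S_def by (rule card_symbols)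
  moreover have "\<dots> = dsum (\<lambda>a i. X ^ ((a + 1) * (a + 1 + m) + a + 1 + i) * (gauss i a * gauss i (a + m + 1))) n"
    by (rule dsum_cong) (metis gauss_commute mult.commute)
  ultimately show ?thesis by simp
qed

theorem theorem1p4:
  fixes m :: int and n :: nat
  assumes "0 \<le> m" and "1 \<le> n"
  shows "q m n \<le> p (- m) n"
proof -
  obtain k where m: "m = int k" using assms(1) nonneg_int_cases by blast
  define P where "P = {xs \<in> partitions n. - m \<le> prank xs}"
  define Q where "Q = {xs \<in> partitions n. m \<in> rank_set xs}"
  have fin: "finite P" "finite Q" using finite_partitions by (simp_all add: P_def Q_def)
  have diff: "P - Q = {xs \<in> partitions n. - int k \<le> prank xs \<and> int k \<notin> rank_set xs}"
    "Q - P = {xs \<in> partitions n. int k \<in> rank_set xs \<and> \<not> - int k \<le> prank xs}"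
    by (auto simp: P_def Q_def m)
  have "int (card (Q - P)) \<le> int (card (P - Q))"
    unfolding diff
    using card_rank_set_only_le[of n k] dsum_symbols[of k n] card_rank_only_ge[of k n] by linarith
  moreover have "card Q = card (P \<inter> Q) + card (Q - P)" "card P = card (P \<inter> Q) + card (P - Q)"
    using card_Int_Diff[OF fin(2), of P] card_Int_Diff[OF fin(1), of Q] by (simp_all add: Int_commute)
  ultimately show ?thesis unfolding q_def p_def P_def Q_def by simp
qed

end
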